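(* Let $(A,u)$ be an orthogonal Hopf $C^*$-algebra, with fundamental corepresentation $u=(u_{ij})\in M_n(A)$, with Haar functional $h:A\to\mathbb C$, and with character $\chi=\mathrm{Tr}(u)=\sum_{i=1}^n u_{ii}$. Let $\pi:A\to M_m(\mathbb C)$ be a representation, given by $u_{ij}\mapsto P_{ij}\in M_m(\mathbb C)$, and for each integer $k\ge 1$ consider the $n^k\times n^k$ matrix $$T_k=\big(\mathrm{tr}(P_{i_1j_1}\cdots P_{i_kj_k})\big)_{i_1\ldots i_k,\,j_1\ldots j_k},$$ where $\mathrm{tr}$ is the normalized trace on $M_m(\mathbb C)$. Then the following are equivalent: (1) $\pi$ is inner faithful. (2) $\#(1\in T_k)\leq h(\chi^k)$ for every $k$.
   Context: An orthogonal Hopf $C^*$-algebra is a unital $C^*$-algebra $A$ with an orthogonal matrix $u\in M_n(A)$ (i.e. $u=\bar u$, where $\bar u=(u_{ij}^* )$, and $u^t=u^{-1}$) whose coefficients $u_{ij}$ generate $A$, such that: the formula $\Delta(u_{ij})=\sum_k u_{ik}\otimes u_{kj}$ defines a morphism of $C^*$-algebras $A\to A\otimes A$ (minimal tensor product); the formula $\varepsilon(u_{ij})=\delta_{ij}$ defines a morphism $A\to\mathbb C$; and the formula $S(u_{ij})=u_{ji}$ defines a morphism $A\to A^{op}$. Morphisms are unital $*$-homomorphisms. The unital $*$-subalgebra $\mathcal A\subset A$ generated by the $u_{ij}$ is a dense Hopf $*$-algebra (the CQG-algebra of $A$). The Haar functional $h$ is the unique state on $A$ with $(h\otimes \mathrm{id})\Delta(a)=h(a)1=(\mathrm{id}\otimes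 h)\Delta(a)$ for all $a\in A$. A representation $\pi:A\to M_m(\mathbb C)$ is a unital $*$-homomorphism. Its Hopf image is the smallest Hopf $C^*$-algebra quotient $A\to A'$ producing a factorization $\pi:A\to A'\to M_m(\mathbb C)$, where Hopf $C^*$-algebras with identical underlying CQG-algebras are identified; thus "smallest" is understood at the level of CQG-algebras, where the CQG-algebra $\mathcal A'$ of $A'$ is the quotient of $\mathcal A$ by the largest Hopf $*$-ideal contained in $\ker(\pi|_{\mathcal A})$. The representation $\pi$ is called inner faithful if $A=A'$ (under this identification: the quotient map $\mathcal A\to\mathcal A'$ is an isomorphism). For a square complex matrix $T$, $\#(\lambda\in T)$ denotes the multiplicity of $\lambda$ as an eigenvalue of $T$, i.e. the dimension of the eigenspace $\ker(T-\lambda)$ (equal to $0$ if $\lambda$ is not an eigenvalue). *)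

theory Defs
  imports "HOL-Analysis.Analysis" "HOL-Library.Function_Algebras"
begin

section \<open>Unital C*-algebras\<close>

text \<open>The class is unital and, because of the axiom \<open>norm 1 = 1\<close> of
  \<^class>\<open>real_normed_algebra_1\<close>, excludes the zero algebra. The latter carries no state and
  no unital homomorphism to the complex numbers, so it is never a Hopf C*-algebra.\<close>

class cstar_algebra = real_normed_algebra_1 + banach +
  fixes scaleC :: "complex \<Rightarrow> 'a \<Rightarrow> 'a"  (infixr \<open>*\<^sub>C\<close> 75)
    and star :: "'a \<Rightarrow> 'a"
  assumes scaleR_scaleC: "scaleR r a = of_real r *\<^sub>C a"
    and scaleC_add_right: "c *\<^sub>C (a + b) = c *\<^sub>C a + c *\<^sub>C b"
    and scaleC_add_left: "(c + d) *\<^sub>C a = c *\<^sub>C a + d *\<^sub>C a"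
    and scaleC_scaleC: "c *\<^sub>C d *\<^sub>C a = (c * d) *\<^sub>C a"
    and scaleC_one: "1 *\<^sub>C a = a"
    and mult_scaleC_left: "(c *\<^sub>C a) * b = c *\<^sub>C (a * b)"
    and mult_scaleC_right: "a * (c *\<^sub>C b) = c *\<^sub>C (a * b)"
    and norm_scaleC: "norm (c *\<^sub>C a) = cmod c * norm a"
    and star_add: "star (a + b) = star a + star b"
    and star_scaleC: "star (c *\<^sub>C a) = cnj c *\<^sub>C star a"
    and star_mult: "star (a * b) = star b * star a"
    and star_star: "star (star a) = a"
    and norm_star_mult_self: "norm (star a * a) = (norm a)\<^sup>2"

instantiation complex :: cstar_algebra
begin

definition scaleC_complex :: "complex \<Rightarrow> complex \<Rightarrow> complex"
  where "scaleC_complex c z = c * z"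

definition star_complex :: "complex \<Rightarrow> complex"
  where "star_complex z = cnj z"

instance
  by standard
    (auto simp: scaleC_complex_def star_complex_def algebra_simps norm_mult power2_eq_square
      scaleR_conv_of_real)

end

global_interpretation cstar: vector_space "scaleC :: complex \<Rightarrow> 'a \<Rightarrow> 'a::cstar_algebra"
  by standard (auto simp: scaleC_add_right scaleC_add_left scaleC_scaleC scaleC_one)

abbreviation clinear :: "('a::cstar_algebra \<Rightarrow> 'b::cstar_algebra) \<Rightarrow> bool"
  where "clinear \<equiv> Vector_Spaces.linear scaleC scaleC"

definition star_hom :: "('a::cstar_algebra \<Rightarrow> 'b::cstar_algebra) \<Rightarrow> bool"
  where "star_hom f \<longleftrightarrow> clinear f \<and> f 1 = 1 \<and> (\<forall>a b. f (a * b) = f a * f b) \<and>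
    (\<forall>a. f (star a) = star (f a))"

text \<open>Morphisms to the opposite algebra of \<open>'b\<close>.\<close>

definition star_antihom :: "('a::cstar_algebra \<Rightarrow> 'b::cstar_algebra) \<Rightarrow> bool"
  where "star_antihom f \<longleftrightarrow> clinear f \<and> f 1 = 1 \<and> (\<forall>a b. f (a * b) = f b * f a) \<and>
    (\<forall>a. f (star a) = star (f a))"

text \<open>On \<^typ>\<open>complex\<close>, \<open>z \<le> w\<close> means that \<open>w - z\<close> is real and nonnegative.\<close>

definition state :: "('a::cstar_algebra \<Rightarrow> complex) \<Rightarrow> bool"
  where "state h \<longleftrightarrow> clinear h \<and> h 1 = 1 \<and> (\<forall>a. 0 \<le> h (star a * a))"

text \<open>The product of \<^typ>\<open>complex^'m^'m\<close> as a matrix algebra is \<open>**\<close>; its \<open>*\<close> is entrywise.\<close>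

definition matrix_representation :: "('a::cstar_algebra \<Rightarrow> complex^'m^'m) \<Rightarrow> bool"
  where "matrix_representation \<pi> \<longleftrightarrow>
    (\<forall>a b. \<pi> (a + b) = \<pi> a + \<pi> b) \<and>
    (\<forall>c a. \<pi> (c *\<^sub>C a) = (\<chi> i j. c * \<pi> a $ i $ j)) \<and>
    (\<forall>a b. \<pi> (a * b) = \<pi> a ** \<pi> b) \<and>
    \<pi> 1 = mat 1 \<and>
    (\<forall>a. \<pi> (star a) = (\<chi> i j. cnj (\<pi> a $ j $ i)))"

definition star_subalgebra :: "'a::cstar_algebra set \<Rightarrow> bool"
  where "star_subalgebra B \<longleftrightarrow> cstar.subspace B \<and> 1 \<in> B \<and> (\<forall>a\<in>B. \<forall>b\<in>B. a * b \<in> B) \<and>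
    (\<forall>a\<in>B. star a \<in> B)"


section \<open>The minimal tensor product\<close>

definition cstar_norm_on :: "'a::cstar_algebra set \<Rightarrow> ('a \<Rightarrow> real) \<Rightarrow> bool"
  where "cstar_norm_on D p \<longleftrightarrow>
    (\<forall>x\<in>D. 0 \<le> p x \<and> (p x = 0 \<longleftrightarrow> x = 0)) \<and>
    (\<forall>x\<in>D. \<forall>y\<in>D. p (x + y) \<le> p x + p y) \<and>
    (\<forall>c. \<forall>x\<in>D. p (c *\<^sub>C x) = cmod c * p x) \<and>
    (\<forall>x\<in>D. \<forall>y\<in>D. p (x * y) \<le> p x * p y) \<and>
    (\<forall>x\<in>D. p (star x * x) = (p x)\<^sup>2)"

text \<open>The linear span of the elementary tensors \<open>a \<otimes> b\<close> with \<open>a \<in> V\<close> and \<open>b \<in> W\<close>.\<close>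

definition tensor_span ::
    "('a \<Rightarrow> 'b \<Rightarrow> 't::cstar_algebra) \<Rightarrow> 'a set \<Rightarrow> 'b set \<Rightarrow> 't set"
  where "tensor_span tens V W = cstar.span {tens a b | a b. a \<in> V \<and> b \<in> W}"

text \<open>\<open>'t\<close>, with elementary tensors \<open>tens a b\<close>, is the completion of the algebraic tensor product
  of \<open>'a\<close> and \<open>'b\<close> for its least C*-norm. The condition on linearly independent families says that
  the linear map from the algebraic tensor product to \<open>'t\<close> induced by \<open>tens\<close> is injective,
  so that the span of the elementary tensors is the algebraic tensor product. These conditions
  determine \<open>'t\<close> and \<open>tens\<close> up to a unique isomorphism.\<close>

definition min_tensor_product ::
    "('a::cstar_algebra \<Rightarrow> 'b::cstar_algebra \<Rightarrow> 't::cstar_algebra) \<Rightarrow> bool"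
  where "min_tensor_product tens \<longleftrightarrow>
    (\<forall>b. clinear (\<lambda>a. tens a b)) \<and>
    (\<forall>a. clinear (\<lambda>b. tens a b)) \<and>
    tens 1 1 = 1 \<and>
    (\<forall>a b a' b'. tens a b * tens a' b' = tens (a * a') (b * b')) \<and>
    (\<forall>a b. star (tens a b) = tens (star a) (star b)) \<and>
    (\<forall>B f. finite B \<and> cstar.independent B \<and> (\<Sum>b\<in>B. tens (f b) b) = 0 \<longrightarrow> (\<forall>b\<in>B. f b = 0)) \<and>
    closure (tensor_span tens UNIV UNIV) = UNIV \<and>
    (\<forall>p. cstar_norm_on (tensor_span tens UNIV UNIV) p \<longrightarrow>
      (\<forall>x\<in>tensor_span tens UNIV UNIV. norm x \<le> p x))"


section \<open>Orthogonal Hopf C*-algebras\<close>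

definition orthogonal_matrix_over :: "('a::cstar_algebra)^'n^'n \<Rightarrow> bool"
  where "orthogonal_matrix_over u \<longleftrightarrow> (\<chi> i j. star (u $ i $ j)) = u \<and>
    transpose u ** u = mat 1 \<and> u ** transpose u = mat 1"

definition cqg_algebra :: "('a::cstar_algebra)^'n^'n \<Rightarrow> 'a set"
  where "cqg_algebra u = star_subalgebra hull {u $ i $ j | i j. True}"

text \<open>The morphisms \<open>\<Delta>\<close>, \<open>\<epsilon>\<close>, \<open>S\<close> are determined by \<open>u\<close>, since the coefficients of \<open>u\<close> generate the
  algebra and morphisms of C*-algebras are continuous.\<close>

definition orthogonal_hopf_cstar_algebra ::
    "('a \<Rightarrow> 'a \<Rightarrow> 't) \<Rightarrow> ('a::cstar_algebra)^'n^'n \<Rightarrow> ('a \<Rightarrow> 't::cstar_algebra) \<Rightarrow>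
      ('a \<Rightarrow> complex) \<Rightarrow> ('a \<Rightarrow> 'a) \<Rightarrow> bool"
  where "orthogonal_hopf_cstar_algebra tens u \<Delta> \<epsilon> S \<longleftrightarrow>
    min_tensor_product tens \<and>
    orthogonal_matrix_over u \<and>
    closure (cqg_algebra u) = UNIV \<and>
    star_hom \<Delta> \<and> (\<forall>i j. \<Delta> (u $ i $ j) = (\<Sum>k\<in>UNIV. tens (u $ i $ k) (u $ k $ j))) \<and>
    star_hom \<epsilon> \<and> (\<forall>i j. \<epsilon> (u $ i $ j) = (if i = j then 1 else 0)) \<and>
    star_antihom S \<and> (\<forall>i j. S (u $ i $ j) = u $ j $ i)"

text \<open>\<open>E\<close> is the slice map \<open>h \<otimes> id\<close> (resp. \<open>id \<otimes> h\<close>) on the minimal tensor product: the unique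
  continuous linear map with the given values on elementary tensors.\<close>

definition left_slice ::
    "('a \<Rightarrow> 'b \<Rightarrow> 't) \<Rightarrow> ('a::cstar_algebra \<Rightarrow> complex) \<Rightarrow>
      ('t::cstar_algebra \<Rightarrow> 'b::cstar_algebra) \<Rightarrow> bool"
  where "left_slice tens h E \<longleftrightarrow> clinear E \<and> continuous_on UNIV E \<and>
    (\<forall>a b. E (tens a b) = h a *\<^sub>C b)"

definition right_slice ::
    "('a \<Rightarrow> 'b \<Rightarrow> 't) \<Rightarrow> ('b::cstar_algebra \<Rightarrow> complex) \<Rightarrow>
      ('t::cstar_algebra \<Rightarrow> 'a::cstar_algebra) \<Rightarrow> bool"
  where "right_slice tens h E \<longleftrightarrow> clinear E \<and> continuous_on UNIV E \<and>
    (\<forall>a b. E (tens a b) = h b *\<^sub>C a)"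

text \<open>There is at most one such \<open>h\<close>: for two of them, \<open>h\<close> and \<open>h'\<close>, evaluating \<open>h \<otimes> h'\<close> on \<open>\<Delta> a\<close>
  in two ways gives \<open>h a = h' a\<close>.\<close>

definition haar_functional ::
    "('a \<Rightarrow> 'a \<Rightarrow> 't) \<Rightarrow> ('a::cstar_algebra \<Rightarrow> 't::cstar_algebra) \<Rightarrow> ('a \<Rightarrow> complex) \<Rightarrow> bool"
  where "haar_functional tens \<Delta> h \<longleftrightarrow> state h \<and>
    (\<exists>E. left_slice tens h E \<and> (\<forall>a. E (\<Delta> a) = h a *\<^sub>C 1)) \<and>
    (\<exists>E. right_slice tens h E \<and> (\<forall>a. E (\<Delta> a) = h a *\<^sub>C 1))"


section \<open>Hopf images and inner faithfulness\<close>

text \<open>\<open>J\<close> is a Hopf *-ideal of the CQG-algebra \<open>\<A>\<close> of \<open>u\<close>. The set on the right of the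
  condition on \<open>\<Delta>\<close> is \<open>J \<otimes> \<A> + \<A> \<otimes> J\<close>, an algebraic tensor product.\<close>

definition hopf_star_ideal ::
    "('a \<Rightarrow> 'a \<Rightarrow> 't) \<Rightarrow> ('a::cstar_algebra)^'n^'n \<Rightarrow> ('a \<Rightarrow> 't::cstar_algebra) \<Rightarrow>
      ('a \<Rightarrow> complex) \<Rightarrow> ('a \<Rightarrow> 'a) \<Rightarrow> 'a set \<Rightarrow> bool"
  where "hopf_star_ideal tens u \<Delta> \<epsilon> S J \<longleftrightarrow>
    J \<subseteq> cqg_algebra u \<and> cstar.subspace J \<and>
    (\<forall>a\<in>cqg_algebra u. \<forall>x\<in>J. a * x \<in> J \<and> x * a \<in> J) \<and>
    (\<forall>x\<in>J. star x \<in> J) \<and>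
    (\<forall>x\<in>J. \<Delta> x \<in> {y + z | y z. y \<in> tensor_span tens J (cqg_algebra u) \<and>
                                z \<in> tensor_span tens (cqg_algebra u) J}) \<and>
    (\<forall>x\<in>J. \<epsilon> x = 0) \<and>
    (\<forall>x\<in>J. S x \<in> J)"

text \<open>The largest Hopf *-ideal contained in the kernel of \<open>\<pi>\<close> on the CQG-algebra; see
  \<open>hopf_image_ideal_greatest\<close> below for its existence.\<close>

definition hopf_image_ideal ::
    "('a \<Rightarrow> 'a \<Rightarrow> 't) \<Rightarrow> ('a::cstar_algebra)^'n^'n \<Rightarrow> ('a \<Rightarrow> 't::cstar_algebra) \<Rightarrow>
      ('a \<Rightarrow> complex) \<Rightarrow> ('a \<Rightarrow> 'a) \<Rightarrow> ('a \<Rightarrow> complex^'m^'m) \<Rightarrow> 'a set"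
  where "hopf_image_ideal tens u \<Delta> \<epsilon> S \<pi> =
    (GREATEST J. hopf_star_ideal tens u \<Delta> \<epsilon> S J \<and> J \<subseteq> {a \<in> cqg_algebra u. \<pi> a = 0})"

definition ideal_rel :: "'a::cstar_algebra set \<Rightarrow> 'a set \<Rightarrow> ('a \<times> 'a) set"
  where "ideal_rel B J = {(a, b). a \<in> B \<and> b \<in> B \<and> a - b \<in> J}"

text \<open>The CQG-algebra of the Hopf image is the quotient of \<open>\<A>\<close> by the ideal above, with the operations
  of \<open>\<A>\<close> on representatives. The quotient map is a Hopf *-homomorphism by construction, so it is
  an isomorphism if and only if it is bijective.\<close>

definition inner_faithful ::
    "('a \<Rightarrow> 'a \<Rightarrow> 't) \<Rightarrow> ('a::cstar_algebra)^'n^'n \<Rightarrow> ('a \<Rightarrow> 't::cstar_algebra) \<Rightarrow>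
      ('a \<Rightarrow> complex) \<Rightarrow> ('a \<Rightarrow> 'a) \<Rightarrow> ('a \<Rightarrow> complex^'m^'m) \<Rightarrow> bool"
  where "inner_faithful tens u \<Delta> \<epsilon> S \<pi> \<longleftrightarrow>
    (let \<A> = cqg_algebra u; R = ideal_rel \<A> (hopf_image_ideal tens u \<Delta> \<epsilon> S \<pi>)
     in bij_betw (\<lambda>a. R `` {a}) \<A> (\<A> // R))"

lemma star_subalgebra_cqg_algebra: "star_subalgebra (cqg_algebra u)"
  unfolding cqg_algebra_def
  by (rule hull_in) (auto simp: star_subalgebra_def cstar.subspace_def)

lemma tensor_span_mono: "V \<subseteq> V' \<Longrightarrow> W \<subseteq> W' \<Longrightarrow> tensor_span tens V W \<subseteq> tensor_span tens V' W'"
  unfolding tensor_span_def by (rule cstar.span_mono) blast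

lemma hopf_image_ideal_greatest:
  fixes \<pi> :: "'a::cstar_algebra \<Rightarrow> complex^'m^'m"
    and tens :: "'a \<Rightarrow> 'a \<Rightarrow> 't::cstar_algebra"
  assumes hopf: "orthogonal_hopf_cstar_algebra tens u \<Delta> \<epsilon> S"
    and rep: "matrix_representation \<pi>"
  defines "P \<equiv> \<lambda>J. hopf_star_ideal tens u \<Delta> \<epsilon> S J \<and> J \<subseteq> {a \<in> cqg_algebra u. \<pi> a = 0}"
  shows "P (hopf_image_ideal tens u \<Delta> \<epsilon> S \<pi>)"
    and "\<And>J. P J \<Longrightarrow> J \<subseteq> hopf_image_ideal tens u \<Delta> \<epsilon> S \<pi>"
proof -
  define M where "M = cstar.span (\<Union>{J. P J})"
  define A where "A = cqg_algebra u"
  have A: "cstar.subspace A"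
    using star_subalgebra_cqg_algebra[of u] by (auto simp: A_def star_subalgebra_def)
  have sM: "cstar.subspace M" by (simp add: M_def)
  have le: "J \<subseteq> M" if "P J" for J
    using that by (auto simp: M_def intro: cstar.span_base)
  have ind: "Q x" if "x \<in> M" and sub: "cstar.subspace (Collect Q)"
    and gen: "\<And>J x. P J \<Longrightarrow> x \<in> J \<Longrightarrow> Q x" for Q x
  proof -
    have "M \<subseteq> Collect Q"
      unfolding M_def by (rule cstar.span_minimal) (use gen sub in auto)
    then show ?thesis using \<open>x \<in> M\<close> by blast
  qed
  have PJ: "J \<subseteq> A" "cstar.subspace J" "\<And>a x. a \<in> A \<Longrightarrow> x \<in> J \<Longrightarrow> a * x \<in> J \<and> x * a \<in> J"
      "\<And>x. x \<in> J \<Longrightarrow> star x \<in> J" "\<And>x. x \<in> J \<Longrightarrow> \<epsilon> x = 0" "\<And>x. x \<in> J \<Longrightarrow> S x \<in> J"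
      "\<And>x. x \<in> J \<Longrightarrow> \<pi> x = 0"
      "\<And>x. x \<in> J \<Longrightarrow> \<exists>y z. \<Delta> x = y + z \<and> y \<in> tensor_span tens J A \<and> z \<in> tensor_span tens A J"
    if "P J" for J
    using that by (auto simp: P_def hopf_star_ideal_def A_def)
  have lin: "clinear \<Delta>" "clinear \<epsilon>" "clinear S"
    using hopf
    by (auto simp: orthogonal_hopf_cstar_algebra_def star_hom_def star_antihom_def)
  note add = lin[THEN Vector_Spaces.linear.axioms(3), THEN module_hom.add]
  note scl = lin[THEN Vector_Spaces.linear.axioms(3), THEN module_hom.scale]
  have zero: "\<Delta> 0 = 0" "\<epsilon> 0 = 0" "S 0 = 0"
    using lin[THEN Vector_Spaces.linear.axioms(3), THEN module_hom.zero] by auto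
  have pi0: "\<pi> 0 = 0"
    using rep unfolding matrix_representation_def
    by (metis add_cancel_right_left)
  have s0: "star 0 = (0::'a)" by (metis add_cancel_right_left star_add)
  have 1: "M \<subseteq> A"
    unfolding M_def by (rule cstar.span_minimal) (use PJ(1) A in auto)
  have 2: "a * x \<in> M \<and> x * a \<in> M" if "a \<in> A" "x \<in> M" for a x
    using \<open>x \<in> M\<close>
  proof (rule ind)
    show "cstar.subspace {x. a * x \<in> M \<and> x * a \<in> M}"
      using sM by (auto simp: cstar.subspace_def distrib_left distrib_right mult_scaleC_left
          mult_scaleC_right)
    show "\<And>J x. P J \<Longrightarrow> x \<in> J \<Longrightarrow> a * x \<in> M \<and> x * a \<in> M"
      using PJ(3) le that(1) by blast
  qed
  have 3: "star x \<in> M" if "x \<in> M" for x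
    using that
  proof (rule ind)
    show "cstar.subspace {x. star x \<in> M}"
      using sM by (auto simp: cstar.subspace_def star_add star_scaleC s0)
    show "\<And>J x. P J \<Longrightarrow> x \<in> J \<Longrightarrow> star x \<in> M" using PJ(4) le by blast
  qed
  have 4: "\<epsilon> x = 0" if "x \<in> M" for x
    using that
  proof (rule ind)
    show "cstar.subspace {x. \<epsilon> x = 0}"
      by (auto simp: cstar.subspace_def add scl zero)
  qed (use PJ(5) in blast)
  have 5: "S x \<in> M" if "x \<in> M" for x
    using that
  proof (rule ind)
    show "cstar.subspace {x. S x \<in> M}"
      using sM by (auto simp: cstar.subspace_def add scl zero)
    show "\<And>J x. P J \<Longrightarrow> x \<in> J \<Longrightarrow> S x \<in> M" using PJ(6) le by blast
  qed
  have 6: "\<pi> x = 0" if "x \<in> M" for x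
    using that
  proof (rule ind)
    show "cstar.subspace {x. \<pi> x = 0}"
      using rep pi0 by (auto simp: cstar.subspace_def matrix_representation_def vec_eq_iff)
  qed (use PJ(7) in blast)
  have 7: "\<Delta> x \<in> {y + z | y z. y \<in> tensor_span tens M A \<and> z \<in> tensor_span tens A M}"
    (is "_ \<in> ?T") if "x \<in> M" for x
    using that
  proof (rule ind)
    have T: "cstar.subspace ?T"
      unfolding tensor_span_def by (rule cstar.subspace_sums) auto
    show "cstar.subspace {x. \<Delta> x \<in> ?T}"
    proof (rule cstar.subspaceI; unfold mem_Collect_eq[where P = "\<lambda>x. \<Delta> x \<in> ?T"] add scl zero)
    qed (fact cstar.subspace_0[OF T], fact cstar.subspace_add[OF T], fact cstar.subspace_scale[OF T])
    show "\<Delta> x \<in> ?T" if "P J" "x \<in> J" for J x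
    proof -
      obtain y z where "y \<in> tensor_span tens J A" "z \<in> tensor_span tens A J" "\<Delta> x = y + z"
        using PJ(8)[OF \<open>P J\<close> \<open>x \<in> J\<close>] by blast
      moreover have "tensor_span tens J A \<subseteq> tensor_span tens M A"
        "tensor_span tens A J \<subseteq> tensor_span tens A M"
        using le[OF \<open>P J\<close>] by (simp_all add: tensor_span_mono)
      ultimately show ?thesis by blast
    qed
  qed
  have "M \<subseteq> {a \<in> A. \<pi> a = 0}" using 1 6 by auto
  then have "P M"
    unfolding P_def hopf_star_ideal_def A_def[symmetric]
    by (intro conjI ballI 1 sM 3 4 5 7 conjunct1[OF 2] conjunct2[OF 2])
  have "hopf_image_ideal tens u \<Delta> \<epsilon> S \<pi> = M"
    unfolding hopf_image_ideal_def
    using \<open>P M\<close>[unfolded P_def] le[unfolded P_def] by (rule Greatest_equality)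
  then show "P (hopf_image_ideal tens u \<Delta> \<epsilon> S \<pi>)"
    and "\<And>J. P J \<Longrightarrow> J \<subseteq> hopf_image_ideal tens u \<Delta> \<epsilon> S \<pi>"
    using \<open>P M\<close> le by simp_all
qed


section \<open>The matrices \<open>T\<^sub>k\<close> and eigenvalue multiplicities\<close>

definition multi_indices :: "nat \<Rightarrow> 'n list set"
  where "multi_indices k = {xs. length xs = k}"

text \<open>For \<open>xs = i\<^sub>1\<dots>i\<^sub>k\<close> and \<open>ys = j\<^sub>1\<dots>j\<^sub>k\<close> of length \<open>k\<close>, the entry of \<open>T\<^sub>k\<close> in row \<open>xs\<close> and column
  \<open>ys\<close>, where \<open>P i j\<close> is the matrix \<open>P\<^sub>i\<^sub>j\<close>.\<close>

definition T_matrix :: "('n \<Rightarrow> 'n \<Rightarrow> complex^'m^'m) \<Rightarrow> 'n list \<Rightarrow> 'n list \<Rightarrow> complex"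
  where "T_matrix P xs ys =
    trace (foldr (**) (map2 P xs ys) (mat 1)) / of_nat CARD('m)"

text \<open>The dimension of the \<open>\<mu>\<close>-eigenspace of the square matrix \<open>T\<close> with rows and columns indexed by
  the finite set \<open>I\<close>. Vectors are functions that vanish outside \<open>I\<close>.\<close>

definition eigenvalue_multiplicity :: "'i set \<Rightarrow> ('i \<Rightarrow> 'i \<Rightarrow> complex) \<Rightarrow> complex \<Rightarrow> nat"
  where "eigenvalue_multiplicity I T \<mu> =
    vector_space.dim (\<lambda>(c::complex) v i. c * v i)
      {v. (\<forall>i. i \<notin> I \<longrightarrow> v i = 0) \<and> (\<forall>i\<in>I. (\<Sum>j\<in>I. T i j * v j) = \<mu> * v i)}"

end

theory Submission
  imports Defs
begin

text \<open>
  Put \<open>\<phi> = tr \<circ> \<pi>\<close>, so that \<open>T\<^sub>k = \<phi>(u\<^bsup>\<otimes>k\<^esup>)\<close>, and \<open>H\<^sub>k = h(u\<^bsup>\<otimes>k\<^esup>)\<close>. By invariance of \<open>h\<close>, the matrix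
  \<open>H\<^sub>k\<close> is an idempotent whose range is the space of fixed vectors of \<open>u\<^bsup>\<otimes>k\<^esup>\<close>, so \<open>h(\<chi>\<^sup>k)\<close>, its trace, is
  the dimension of that space. Every fixed vector of \<open>u\<^bsup>\<otimes>k\<^esup>\<close> is fixed by \<open>T\<^sub>k\<close>. Hence the inequality
  between the dimensions says exactly that \<open>T\<^sub>k\<close> has the same fixed vectors as \<open>u\<^bsup>\<otimes>k\<^esup>\<close>
  (lemma \<open>multiplicity_le_iff\<close>), and the theorem becomes: \<open>\<pi>\<close> is inner faithful if and only if this
  holds for all \<open>k\<close>.

  Suppose that \<open>\<pi>\<close> is inner faithful and \<open>T\<^sub>k v = v\<close>. Since \<open>u\<^bsup>\<otimes>k\<^esup>\<close> is unitary and the trace is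
  faithful, the equality case of the Cauchy-Schwarz inequality shows that \<open>\<pi>\<close> kills the components of
  \<open>u\<^bsup>\<otimes>k\<^esup> v - v\<close> (lemma \<open>pi_defect_zero\<close>). The ideal generated by all these components is a Hopf
  *-ideal contained in the kernel of \<open>\<pi>\<close> (lemma \<open>hopf_star_ideal_defect_ideal\<close>), so it is zero and \<open>v\<close>
  is fixed by \<open>u\<^bsup>\<otimes>k\<^esup>\<close>.

  Conversely, suppose that the fixed vectors agree, and let \<open>J\<close> be a Hopf *-ideal in the kernel of
  \<open>\<pi>\<close>. The convolution operator \<open>\<tau> = (id \<otimes> \<phi>) \<Delta>\<close> preserves \<open>J\<close> and \<open>h\<close>. Agreement of the fixed vectors
  makes \<open>1 - T\<^sub>k + H\<^sub>k\<close> invertible, from which \<open>1 - \<tau>\<close> maps \<open>J\<close> onto itself; therefore \<open>h\<close> vanishes on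
  \<open>J\<close> (lemma \<open>haar_vanishes_on_ideal\<close>). Finally a Hopf ideal on which \<open>h\<close> vanishes is zero, by the
  strong invariance of the Haar functional (lemma \<open>ideal_trivial_if_haar_vanishes\<close>).
\<close>

section \<open>Linear algebra in finite-dimensional subspaces\<close>

lemma (in vector_space) subspace_eq_if_dim_le:
  assumes "subspace G" "G \<subseteq> F" "F \<subseteq> span T" "finite T" "dim F \<le> dim G"
  shows "F = G"
proof -
  obtain B where B: "B \<subseteq> G" "independent B" "G \<subseteq> span B"
    using maximal_independent_subset by blast
  obtain B' where B': "B \<subseteq> B'" "B' \<subseteq> F" "independent B'" "F \<subseteq> span B'"
    using maximal_independent_subset_extend[of B F] B assms(2) by blast
  have "finite B'"
    using independent_span_bound[OF assms(4) B'(3)] B'(2) assms(3) by blast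
  moreover have "card B' \<le> card B"
    using basis_card_eq_dim[OF B'(2,4,3)] basis_card_eq_dim[OF B(1,3,2)] assms(5) by simp
  ultimately have "B = B'" using B'(1) by (metis card_seteq)
  then have "F \<subseteq> span G" using B'(4) span_mono[OF B(1)] by blast
  then show ?thesis using assms(1,2) span_eq_iff by blast
qed

lemma injective_imp_surjective_on_subspace:
  fixes scale :: "'f::field \<Rightarrow> 'v::ab_group_add \<Rightarrow> 'v" (infixr \<open>*s\<close> 75)
  assumes g: "Vector_Spaces.linear scale scale g"
    and W: "module.subspace scale W" "W \<subseteq> module.span scale T" "finite T" "g ` W \<subseteq> W"
    and inj: "\<And>w. w \<in> W \<Longrightarrow> g w = 0 \<Longrightarrow> w = 0"
  shows "g ` W = W"
proof -
  interpret V: vector_space scale using g by (rule Vector_Spaces.linear.axioms(1))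
  interpret VV: vector_space_pair scale scale ..
  have "inj_on g W"
    using VV.linear_inj_on_iff_eq_0[OF g W(1)] inj by blast
  obtain B where B: "B \<subseteq> W" "V.independent B" "W \<subseteq> V.span B"
    using V.maximal_independent_subset by blast
  have spanB: "V.span B = W"
    using B W(1) V.span_minimal by blast
  have finB: "finite B"
    using V.independent_span_bound[OF W(3) B(2)] B(1) W(2) by blast
  have indep: "V.independent (g ` B)"
    using VV.linear_independent_injective_image[OF g B(2)] \<open>inj_on g W\<close> spanB by simp
  have "card (g ` B) = card B"
    using \<open>inj_on g W\<close> B(1) by (meson card_image inj_on_subset)
  then have "V.dim W \<le> V.dim (V.span (g ` B))"
    using V.dim_span_eq_card_independent[OF indep] V.basis_card_eq_dim[OF B(1,3,2)] by simp
  moreover have "V.span (g ` B) \<subseteq> W"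
    using B(1) W(1,4) by (intro V.span_minimal) auto
  ultimately have "W = V.span (g ` B)"
    using W by (intro V.subspace_eq_if_dim_le[of _ _ T]) auto
  also have "\<dots> = g ` W"
    using VV.linear_span_image[OF g, of B] spanB by simp
  finally show ?thesis by simp
qed

lemma surjective_imp_injective_on_subspace:
  fixes scale :: "'f::field \<Rightarrow> 'v::ab_group_add \<Rightarrow> 'v" (infixr \<open>*s\<close> 75)
  assumes g: "Vector_Spaces.linear scale scale g"
    and W: "module.subspace scale W" "W \<subseteq> module.span scale T" "finite T"
    and surj: "g ` W = W"
  shows "inj_on g W"
proof -
  interpret V: vector_space scale using g by (rule Vector_Spaces.linear.axioms(1))
  interpret VV: vector_space_pair scale scale ..
  obtain r where r: "range r \<subseteq> W" "Vector_Spaces.linear scale scale r" "\<forall>w\<in>W. g (r w) = w"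
    using VV.linear_exists_right_inverse_on[OF g W(1)] surj by auto
  have "g 0 = 0"
    using VV.linear_0[OF g] .
  \<comment> \<open>A linear section of \<open>g\<close> is injective, hence onto, so that \<open>g\<close> is a two-sided inverse of it.\<close>
  have "r ` W = W"
  proof (rule injective_imp_surjective_on_subspace[OF r(2) W])
    show "r ` W \<subseteq> W" using r(1) by blast
    show "\<And>w. w \<in> W \<Longrightarrow> r w = 0 \<Longrightarrow> w = 0" using r(3) \<open>g 0 = 0\<close> by metis
  qed
  then show ?thesis
    using r(3) by (intro inj_onI) (metis imageE)
qed

global_interpretation cfun: vector_space "\<lambda>(c::complex) (v::'i \<Rightarrow> complex) i. c * v i"
  by standard (auto simp: fun_eq_iff algebra_simps)

definition fixed_vectors :: "'i set \<Rightarrow> ('i \<Rightarrow> 'i \<Rightarrow> complex) \<Rightarrow> ('i \<Rightarrow> complex) set"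
  where "fixed_vectors I T =
    {v. (\<forall>i. i \<notin> I \<longrightarrow> v i = 0) \<and> (\<forall>i\<in>I. (\<Sum>j\<in>I. T i j * v j) = v i)}"

lemma eigenvalue_multiplicity_1: "eigenvalue_multiplicity I T 1 = cfun.dim (fixed_vectors I T)"
  by (simp add: eigenvalue_multiplicity_def fixed_vectors_def)

lemma subspace_fixed_vectors: "cfun.subspace (fixed_vectors I T)"
  by (auto simp: cfun.subspace_def fixed_vectors_def distrib_left sum.distrib mult.left_commute
      simp flip: sum_distrib_left)

lemma supported_in_span:
  assumes "finite I" "\<And>i. i \<notin> I \<Longrightarrow> v i = 0"
  shows "v \<in> cfun.span ((\<lambda>i k. if k = i then 1 else 0) ` I)"
proof -
  have "v = (\<Sum>i\<in>I. (\<lambda>k. v i * (if k = i then 1 else 0)))"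
  proof
    fix k
    have "(\<Sum>i\<in>I. (\<lambda>k. v i * (if k = i then 1 else 0))) k
      = (\<Sum>i\<in>I. v i * (if k = i then 1 else 0))"
      by (induction I rule: infinite_finite_induct) auto
    also have "\<dots> = v k"
      using assms by (simp add: if_distrib[of "(*) _"] sum.delta cong: if_cong)
    finally show "v k = (\<Sum>i\<in>I. (\<lambda>k. v i * (if k = i then 1 else 0))) k" ..
  qed
  also have "\<dots> \<in> cfun.span ((\<lambda>i k. if k = i then 1 else 0) ` I)"
    by (intro cfun.span_sum cfun.span_scale cfun.span_base) auto
  finally show ?thesis .
qed

lemma fixed_vectors_eq_if_dim_le:
  assumes "finite I" "fixed_vectors I H \<subseteq> fixed_vectors I T"
    and "eigenvalue_multiplicity I T 1 \<le> eigenvalue_multiplicity I H 1"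
  shows "fixed_vectors I T = fixed_vectors I H"
proof (rule cfun.subspace_eq_if_dim_le)
  show "fixed_vectors I T \<subseteq> cfun.span ((\<lambda>i k. if k = i then 1 else 0) ` I)"
    using supported_in_span[OF assms(1)] by (auto simp: fixed_vectors_def)
qed (use assms in \<open>auto simp: subspace_fixed_vectors eigenvalue_multiplicity_1\<close>)

lemma sum_fun_apply: "sum f A x = (\<Sum>a\<in>A. f a x)"
  by (induction A rule: infinite_finite_induct) auto

text \<open>Write the \<open>j\<close>-th column of \<open>H\<close> as \<open>\<Sum>\<^sub>b c\<^sub>b(j) b\<close> in a basis of the range. Since \<open>H\<close> fixes
  every basis vector, the rows \<open>c\<^sub>b\<close> form the dual family, \<open>\<Sum>\<^sub>j c\<^sub>b(j) b'(j) = \<delta>\<^sub>b\<^sub>b\<^sub>'\<close>, and the trace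
  \<open>\<Sum>\<^sub>b \<Sum>\<^sub>j c\<^sub>b(j) b(j)\<close> counts the basis.\<close>

lemma trace_idempotent:
  assumes I: "finite I"
    and idem: "\<And>i j. i \<in> I \<Longrightarrow> j \<in> I \<Longrightarrow> (\<Sum>k\<in>I. H i k * H k j) = H i j"
  shows "(\<Sum>i\<in>I. H i i) = of_nat (eigenvalue_multiplicity I H 1)"
proof -
  let ?F = "fixed_vectors I H"
  let ?scale = "\<lambda>(c::complex) v i. c * v i"
  define col where "col j i = (if i \<in> I then H i j else 0)" for j i
  obtain B where B: "B \<subseteq> ?F" "cfun.independent B" "?F \<subseteq> cfun.span B" "card B = cfun.dim ?F"
    using cfun.basis_exists by blast
  have finB: "finite B"
    using cfun.independent_span_bound[OF finite_imageI[OF I] B(2)] B(1) supported_in_span[OF I]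
    unfolding fixed_vectors_def by blast
  define c where "c b j = cfun.representation B (col j) b" for b j
  have col: "col j \<in> cfun.span B" if "j \<in> I" for j
    using that B(3) idem by (auto simp: fixed_vectors_def col_def)
  have col_eq: "H i j = (\<Sum>b\<in>B. c b j * b i)" if "i \<in> I" "j \<in> I" for i j
  proof -
    have "(\<Sum>b\<in>B. (\<lambda>i. c b j * b i)) i = col j i"
      unfolding c_def using cfun.sum_representation_eq[OF B(2) col finB] that by simp
    then show ?thesis using that by (simp add: col_def sum_fun_apply)
  qed
  have dual: "(\<Sum>j\<in>I. b j * c b j) = 1" if b: "b \<in> B" for b
  proof -
    have "b i = (\<Sum>j\<in>I. (\<lambda>i. b j * col j i)) i" for i
      using B(1) b
      by (cases "i \<in> I") (auto simp: fixed_vectors_def col_def sum_fun_apply mult.commute)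
    then have *: "b = (\<Sum>j\<in>I. ?scale (b j) (col j))" by blast
    have "1 = cfun.representation B b b"
      using cfun.representation_basis[OF B(2) b] by simp
    also have "\<dots> = cfun.representation B (\<Sum>j\<in>I. ?scale (b j) (col j)) b"
      using * by simp
    also have "\<dots> = (\<Sum>j\<in>I. cfun.representation B (?scale (b j) (col j)) b)"
      by (subst cfun.representation_sum[OF B(2)]) (auto intro: cfun.span_scale col)
    also have "\<dots> = (\<Sum>j\<in>I. b j * c b j)"
      by (intro sum.cong) (auto simp: cfun.representation_scale[OF B(2) col] c_def)
    finally show ?thesis by simp
  qed
  have "(\<Sum>i\<in>I. H i i) = (\<Sum>b\<in>B. \<Sum>i\<in>I. b i * c b i)"
    by (subst sum.swap) (auto simp: col_eq mult.commute intro!: sum.cong)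
  also have "\<dots> = of_nat (card B)"
    using dual by simp
  finally show ?thesis
    by (simp add: B(4) eigenvalue_multiplicity_1)
qed

section \<open>Bilinear maps and the algebraic tensor product\<close>

lemma clinearI:
  assumes "\<And>a b. f (a + b) = f a + f b" "\<And>c a. f (c *\<^sub>C a) = c *\<^sub>C f a"
  shows "clinear f"
  using assms by (simp add: Vector_Spaces.linear_iff cstar.vector_space_axioms)

context
  fixes f :: "'a::cstar_algebra \<Rightarrow> 'b::cstar_algebra"
  assumes f: "clinear f"
begin

lemma clinear_add: "f (a + b) = f a + f b"
  and clinear_scale: "f (c *\<^sub>C a) = c *\<^sub>C f a"
  and clinear_zero: "f 0 = 0"
  and clinear_diff: "f (a - b) = f a - f b"
  and clinear_sum: "f (sum g I) = (\<Sum>i\<in>I. f (g i))"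
  using module_hom.add module_hom.scale module_hom.zero module_hom.diff module_hom.sum
    Vector_Spaces.linear.axioms(3)[OF f] by metis+

end

lemma clinear_times: "clinear (\<lambda>x. x * y)" "clinear (\<lambda>x. y * x)" for y :: "'c::cstar_algebra"
  by (auto intro!: clinearI simp: distrib_left distrib_right mult_scaleC_left mult_scaleC_right)

lemma clinear_eq_on_span:
  assumes "clinear f" "clinear g" "x \<in> cstar.span B" "\<And>b. b \<in> B \<Longrightarrow> f b = g b"
  shows "f x = g x"
proof -
  interpret vector_space_pair "scaleC :: complex \<Rightarrow> 'a \<Rightarrow> 'a" "scaleC :: complex \<Rightarrow> 'b \<Rightarrow> 'b" ..
  show ?thesis using linear_eq_on assms by metis
qed

lemma clinear_preimage_subspace: "clinear f \<Longrightarrow> cstar.subspace W \<Longrightarrow> cstar.subspace {x. f x \<in> W}"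
  by (auto simp: cstar.subspace_def clinear_add clinear_scale clinear_zero)

lemma clinear_span_into:
  assumes "clinear f" "x \<in> cstar.span B" "cstar.subspace W" "\<And>b. b \<in> B \<Longrightarrow> f b \<in> W"
  shows "f x \<in> W"
proof -
  have "cstar.span B \<subseteq> {x. f x \<in> W}"
    using assms by (intro cstar.span_minimal clinear_preimage_subspace) auto
  with assms(2) show ?thesis by blast
qed

lemma cstar_zero: "star 0 = (0::'a::cstar_algebra)"
  by (metis add_cancel_right_left star_add)

lemma cstar_sum: "star (sum f I) = (\<Sum>i\<in>I. star (f i :: 'a::cstar_algebra))"
  by (induction I rule: infinite_finite_induct) (auto simp: star_add cstar_zero)

lemma cstar_diff: "star (a - b) = star a - star (b :: 'a::cstar_algebra)"
  by (metis add_diff_cancel diff_add_cancel star_add)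

lemma cstar_one: "star 1 = (1 :: 'a::cstar_algebra)"
  by (metis mult.right_neutral star_mult star_star)

locale cstar_tensor =
  fixes tens :: "'a::cstar_algebra \<Rightarrow> 'b::cstar_algebra \<Rightarrow> 't::cstar_algebra"
  assumes min_tensor_product: "min_tensor_product tens"
begin

lemma tens_linear_left: "clinear (\<lambda>a. tens a b)" and tens_linear_right: "clinear (tens a)"
  using min_tensor_product by (simp_all add: min_tensor_product_def)

lemma tens_mult: "tens a b * tens a' b' = tens (a * a') (b * b')"
  and tens_star: "star (tens a b) = tens (star a) (star b)"
  and tens_one: "tens 1 1 = 1"
  using min_tensor_product by (simp_all add: min_tensor_product_def)

lemma tens_independent:
  "finite B \<Longrightarrow> cstar.independent B \<Longrightarrow> (\<Sum>b\<in>B. tens (f b) b) = 0 \<Longrightarrow> b \<in> B \<Longrightarrow> f b = 0"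
proof -
  have "\<forall>B f. finite B \<and> cstar.independent B \<and> (\<Sum>b\<in>B. tens (f b) b) = 0 \<longrightarrow> (\<forall>b\<in>B. f b = 0)"
    using min_tensor_product unfolding min_tensor_product_def by (elim conjE)
  then show "finite B \<Longrightarrow> cstar.independent B \<Longrightarrow> (\<Sum>b\<in>B. tens (f b) b) = 0 \<Longrightarrow> b \<in> B \<Longrightarrow> f b = 0"
    by blast
qed

lemmas tens_simps =
  clinear_add[OF tens_linear_left] clinear_scale[OF tens_linear_left]
  clinear_sum[OF tens_linear_left] clinear_zero[OF tens_linear_left]
  clinear_diff[OF tens_linear_left]
  clinear_add[OF tens_linear_right] clinear_scale[OF tens_linear_right]
  clinear_sum[OF tens_linear_right] clinear_zero[OF tens_linear_right]
  clinear_diff[OF tens_linear_right]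

text \<open>Grouping the combination by its second factors, the independence condition of the tensor product
kills the first factors \<open>\<Sum>\<^sub>a r(a,b) a\<close>, and then independence of \<open>A\<close> kills the coefficients.\<close>

lemma tens_basis_coefficients_zero:
  assumes A: "cstar.independent A" and B: "cstar.independent B"
    and P: "finite P" "P \<subseteq> A \<times> B"
    and zero: "(\<Sum>p\<in>P. r p *\<^sub>C tens (fst p) (snd p)) = 0"
    and p: "p \<in> P"
  shows "r p = 0"
proof -
  define A' where "A' = fst ` P"
  define B' where "B' = snd ` P"
  define r' where "r' p = (if p \<in> P then r p else 0)" for p
  have fin: "finite A'" "finite B'" using P by (auto simp: A'_def B'_def)
  have sub: "A' \<subseteq> A" "B' \<subseteq> B" "P \<subseteq> A' \<times> B'"
    using P(2) by (auto simp: A'_def B'_def rev_image_eqI)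
  have indep: "cstar.independent A'" "cstar.independent B'"
    using A B sub cstar.independent_mono by blast+
  have "(\<Sum>p\<in>P. r p *\<^sub>C tens (fst p) (snd p))
    = (\<Sum>p\<in>A' \<times> B'. r' p *\<^sub>C tens (fst p) (snd p))"
    by (rule sum.mono_neutral_cong_left) (use fin sub in \<open>auto simp: r'_def\<close>)
  then have "0 = (\<Sum>p\<in>A' \<times> B'. r' p *\<^sub>C tens (fst p) (snd p))"
    by (simp only: zero)
  also have "\<dots> = (\<Sum>a\<in>A'. \<Sum>b\<in>B'. r' (a, b) *\<^sub>C tens a b)"
    by (simp add: sum.cartesian_product split_def)
  also have "\<dots> = (\<Sum>b\<in>B'. \<Sum>a\<in>A'. r' (a, b) *\<^sub>C tens a b)"
    by (rule sum.swap)
  also have "\<dots> = (\<Sum>b\<in>B'. tens (\<Sum>a\<in>A'. r' (a, b) *\<^sub>C a) b)"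
    by (simp add: tens_simps)
  finally have "(\<Sum>a\<in>A'. r' (a, b) *\<^sub>C a) = 0" if "b \<in> B'" for b
    using tens_independent[OF fin(2) indep(2), of "\<lambda>b. \<Sum>a\<in>A'. r' (a, b) *\<^sub>C a"] that by simp
  then have r': "r' (a, b) = 0" if "b \<in> B'" "a \<in> A'" for a b
    using cstar.independentD[OF indep(1) fin(1) order_refl, of "\<lambda>a. r' (a, b)" a] that by simp
  obtain a b where "p = (a, b)" by (cases p)
  with p sub(3) r'[of b a] show ?thesis by (auto simp: r'_def)
qed

text \<open>The universal property of the algebraic tensor product: by the previous lemma the tensors of two
  bases are linearly independent, so a linear map may be prescribed on them.\<close>

lemma bilinear_extension:
  fixes \<beta> :: "'a \<Rightarrow> 'b \<Rightarrow> 'c::cstar_algebra"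
  assumes left: "\<And>b. clinear (\<lambda>a. \<beta> a b)" and right: "\<And>a. clinear (\<beta> a)"
  obtains g where "clinear g" "\<And>a b. g (tens a b) = \<beta> a b"
proof -
  interpret vector_space_pair "scaleC :: complex \<Rightarrow> 't \<Rightarrow> 't" "scaleC :: complex \<Rightarrow> 'c \<Rightarrow> 'c" ..
  obtain A :: "'a set" where "A \<subseteq> UNIV" and A: "cstar.independent A" "UNIV \<subseteq> cstar.span A"
    by (rule cstar.maximal_independent_subset)
  obtain B :: "'b set" where "B \<subseteq> UNIV" and B: "cstar.independent B" "UNIV \<subseteq> cstar.span B"
    by (rule cstar.maximal_independent_subset)
  let ?t = "\<lambda>p. tens (fst p) (snd p)"
  note coeff = tens_basis_coefficients_zero[OF A(1) B(1)]
  have inj: "inj_on ?t (A \<times> B)"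
  proof (rule inj_onI, rule ccontr)
    fix p q assume pq: "p \<in> A \<times> B" "q \<in> A \<times> B" "?t p = ?t q" "p \<noteq> q"
    let ?r = "\<lambda>s. if s = p then 1 else - 1 :: complex"
    have "(\<Sum>s\<in>{p, q}. ?r s *\<^sub>C ?t s) = 0"
      using pq by (simp add: cstar.scale_minus_left)
    from coeff[OF _ _ this, of p] pq show False by auto
  qed
  have "cstar.independent (?t ` (A \<times> B))"
    unfolding cstar.independent_explicit_finite_subsets
  proof (intro allI impI ballI)
    fix X r x
    assume X: "X \<subseteq> ?t ` (A \<times> B)" "finite X" "(\<Sum>v\<in>X. r v *\<^sub>C v) = 0" "x \<in> X"
    obtain P where P: "P \<subseteq> A \<times> B" "X = ?t ` P"
      using X(1) by (meson subset_imageE)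
    have injP: "inj_on ?t P" using inj P(1) by (rule inj_on_subset)
    have finP: "finite P" using X(2) P(2) injP finite_imageD by blast
    obtain p where p: "p \<in> P" "x = ?t p" using X(4) P(2) by blast
    have "(\<Sum>p\<in>P. r (?t p) *\<^sub>C ?t p) = 0"
      using X(3) unfolding P(2) by (simp add: sum.reindex[OF injP])
    from coeff[OF finP P(1) this p(1)] show "r x = 0" using p(2) by simp
  qed
  from linear_independent_extend[OF this,
      of "\<lambda>x. (\<lambda>p. \<beta> (fst p) (snd p)) (inv_into (A \<times> B) ?t x)"]
  obtain g where g: "clinear g"
    "\<forall>x\<in>?t ` (A \<times> B). g x = (\<lambda>p. \<beta> (fst p) (snd p)) (inv_into (A \<times> B) ?t x)"
    by auto
  have base: "g (tens a b) = \<beta> a b" if "a \<in> A" "b \<in> B" for a b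
    using g(2) inv_into_f_f[OF inj, of "(a, b)"] that by auto
  have lin_left: "clinear (\<lambda>a. g (tens a b))" for b
    by (rule clinearI) (simp_all add: tens_simps clinear_add[OF g(1)] clinear_scale[OF g(1)])
  have lin_right: "clinear (\<lambda>b. g (tens a b))" for a
    by (rule clinearI) (simp_all add: tens_simps clinear_add[OF g(1)] clinear_scale[OF g(1)])
  have "g (tens a b) = \<beta> a b" if "b \<in> B" for a b
    using clinear_eq_on_span[OF lin_left left, of a A] A(2) base that by blast
  then have "g (tens a b) = \<beta> a b" for a b
    using clinear_eq_on_span[OF lin_right right, of b B] B(2) by blast
  with g(1) that show thesis by blast
qed

lemma tensor_span_tens: "a \<in> V \<Longrightarrow> b \<in> W \<Longrightarrow> tens a b \<in> tensor_span tens V W"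
  unfolding tensor_span_def by (intro cstar.span_base) blast

lemma subspace_tensor_span: "cstar.subspace (tensor_span tens V W)"
  unfolding tensor_span_def by simp

lemma tensor_span_into:
  assumes "clinear f" "t \<in> tensor_span tens V W" "cstar.subspace X"
    and "\<And>a b. a \<in> V \<Longrightarrow> b \<in> W \<Longrightarrow> f (tens a b) \<in> X"
  shows "f t \<in> X"
  using clinear_span_into[OF assms(1) assms(2)[unfolded tensor_span_def] assms(3)] assms(4) by blast

lemma tensor_span_zero:
  assumes "clinear f" "t \<in> tensor_span tens V W"
    and "\<And>a b. a \<in> V \<Longrightarrow> b \<in> W \<Longrightarrow> f (tens a b) = 0"
  shows "f t = 0"
  using tensor_span_into[OF assms(1,2), of "{0}"] assms(3) by (auto simp: cstar.subspace_def)

lemma tensor_span_mult: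
  assumes "s \<in> tensor_span tens V W" "t \<in> tensor_span tens V' W'"
    and V: "\<And>a a'. a \<in> V \<Longrightarrow> a' \<in> V' \<Longrightarrow> a * a' \<in> X"
    and W: "\<And>b b'. b \<in> W \<Longrightarrow> b' \<in> W' \<Longrightarrow> b * b' \<in> Y"
  shows "s * t \<in> tensor_span tens X Y"
proof (rule tensor_span_into[OF clinear_times(1) assms(1) subspace_tensor_span])
  fix a b assume "a \<in> V" "b \<in> W"
  then show "tens a b * t \<in> tensor_span tens X Y"
    using V W by (intro tensor_span_into[OF clinear_times(2) assms(2) subspace_tensor_span])
      (simp add: tens_mult tensor_span_tens)
qed

end

section \<open>Entries of the tensor powers of the fundamental corepresentation\<close>

definition tensor_power_entry :: "('a::cstar_algebra)^'n^'n \<Rightarrow> 'n list \<Rightarrow> 'n list \<Rightarrow> 'a"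
  where "tensor_power_entry u xs ys = prod_list (map2 (\<lambda>i j. u $ i $ j) xs ys)"

lemma finite_multi_indices: "finite (multi_indices k :: 'n::finite list set)"
  using finite_lists_length_eq[of "UNIV :: 'n set" k] by (simp add: multi_indices_def)

lemma multi_indices_0: "multi_indices 0 = {[]}"
  by (auto simp: multi_indices_def)

lemma sum_multi_indices_Suc:
  fixes f :: "'n::finite list \<Rightarrow> 'a::comm_monoid_add"
  shows "(\<Sum>zs\<in>multi_indices (Suc k). f zs) = (\<Sum>z\<in>UNIV. \<Sum>zs\<in>multi_indices k. f (z # zs))"
proof -
  have eq: "(multi_indices (Suc k) :: 'n list set) = (\<lambda>(z, zs). z # zs) ` (UNIV \<times> multi_indices k)"
    by (auto simp: multi_indices_def length_Suc_conv)
  have inj: "inj_on (\<lambda>(z, zs). z # zs) (UNIV \<times> multi_indices k :: ('n \<times> 'n list) set)"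
    by (auto simp: inj_on_def)
  show ?thesis
    unfolding eq sum.reindex[OF inj] by (simp add: sum.cartesian_product split_def)
qed

lemma sum_indicator_scale:
  "finite I \<Longrightarrow> j \<in> I \<Longrightarrow> (\<Sum>i\<in>I. (if i = j then 1 else 0) *\<^sub>C f i) = (f j :: 'a::cstar_algebra)"
  by (simp add: if_distrib[of "\<lambda>c. c *\<^sub>C _"] sum.delta cong: if_cong)

lemma trace_power_eq:
  fixes u :: "('a::cstar_algebra)^'n^'n"
  shows "trace u ^ k = (\<Sum>xs\<in>multi_indices k. tensor_power_entry u xs xs)"
  by (induction k)
    (simp_all add: multi_indices_0 tensor_power_entry_def sum_multi_indices_Suc trace_def
      sum_product)

locale orthogonal_hopf =
  fixes tens :: "'a::cstar_algebra \<Rightarrow> 'a \<Rightarrow> 't::cstar_algebra"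
    and u :: "'a^'n^'n"
    and \<Delta> :: "'a \<Rightarrow> 't" and \<epsilon> :: "'a \<Rightarrow> complex" and S :: "'a \<Rightarrow> 'a"
  assumes hopf: "orthogonal_hopf_cstar_algebra tens u \<Delta> \<epsilon> S"
begin

sublocale cstar_tensor tens
  using hopf by unfold_locales (simp add: orthogonal_hopf_cstar_algebra_def)

abbreviation U :: "'n list \<Rightarrow> 'n list \<Rightarrow> 'a"
  where "U \<equiv> tensor_power_entry u"

abbreviation \<A> :: "'a set"
  where "\<A> \<equiv> cqg_algebra u"

lemma Delta_linear: "clinear \<Delta>" and eps_linear: "clinear \<epsilon>" and S_linear: "clinear S"
  and Delta_one: "\<Delta> 1 = 1" and eps_one: "\<epsilon> 1 = 1" and S_one: "S 1 = 1"
  and Delta_mult: "\<Delta> (a * b) = \<Delta> a * \<Delta> b" and eps_mult: "\<epsilon> (a * b) = \<epsilon> a * \<epsilon> b"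
  and S_mult: "S (a * b) = S b * S a"
  and Delta_star: "\<Delta> (star a) = star (\<Delta> a)"
  and Delta_u: "\<Delta> (u $ i $ j) = (\<Sum>k\<in>UNIV. tens (u $ i $ k) (u $ k $ j))"
  and eps_u: "\<epsilon> (u $ i $ j) = (if i = j then 1 else 0)" and S_u: "S (u $ i $ j) = u $ j $ i"
  using hopf by (simp_all add: orthogonal_hopf_cstar_algebra_def star_hom_def star_antihom_def)

lemma star_u: "star (u $ i $ j) = u $ i $ j"
  and orthogonal_columns: "(\<Sum>k\<in>UNIV. u $ k $ i * u $ k $ j) = (if i = j then 1 else 0)"
  and orthogonal_rows: "(\<Sum>k\<in>UNIV. u $ i $ k * u $ j $ k) = (if i = j then 1 else 0)"
  using hopf
  by (simp_all add: orthogonal_hopf_cstar_algebra_def orthogonal_matrix_over_def vec_eq_iff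
      matrix_matrix_mult_def transpose_def mat_def)

lemma U_Nil [simp]: "U [] [] = 1"
  and U_Cons [simp]: "U (x # xs) (y # ys) = u $ x $ y * U xs ys"
  by (simp_all add: tensor_power_entry_def)

lemma U_append:
  "length xs = length ys \<Longrightarrow> U (xs @ xs') (ys @ ys') = U xs ys * U xs' ys'"
  by (simp add: tensor_power_entry_def)

lemma star_U: "length xs = length ys \<Longrightarrow> star (U xs ys) = U (rev xs) (rev ys)"
  by (induction xs ys rule: list_induct2)
    (simp_all add: cstar_one star_mult star_u U_append)

lemma S_U: "length xs = length ys \<Longrightarrow> S (U xs ys) = star (U ys xs)"
  by (induction xs ys rule: list_induct2) (simp_all add: S_one cstar_one S_mult star_mult S_u star_u)

lemma eps_U: "length xs = length ys \<Longrightarrow> \<epsilon> (U xs ys) = (if xs = ys then 1 else 0)"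
  by (induction xs ys rule: list_induct2) (simp_all add: eps_one eps_mult eps_u)

lemma Delta_U_aux:
  "length xs = length ys \<Longrightarrow>
    \<Delta> (U xs ys) = (\<Sum>zs\<in>multi_indices (length xs). tens (U xs zs) (U zs ys))"
  by (induction xs ys rule: list_induct2)
    (simp_all add: multi_indices_0 Delta_one tens_one sum_multi_indices_Suc Delta_mult Delta_u
      sum_product tens_mult)

lemma Delta_U:
  "xs \<in> multi_indices k \<Longrightarrow> ys \<in> multi_indices k \<Longrightarrow>
    \<Delta> (U xs ys) = (\<Sum>zs\<in>multi_indices k. tens (U xs zs) (U zs ys))"
  using Delta_U_aux[of xs ys] by (simp add: multi_indices_def)

text \<open>With the next lemma this says that \<open>u\<^bsup>\<otimes>k\<^esup>\<close> is unitary; since \<open>S(u\<^bsup>\<otimes>k\<^esup>)\<close> is its adjoint, these are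
also the antipode identities.\<close>

lemma U_isometry:
  assumes "xs \<in> multi_indices k" "ys \<in> multi_indices k"
  shows "(\<Sum>zs\<in>multi_indices k. star (U zs xs) * U zs ys) = (if xs = ys then 1 else 0)"
proof -
  have "length xs = length ys \<Longrightarrow>
    (\<Sum>zs\<in>multi_indices (length xs). star (U zs xs) * U zs ys) = (if xs = ys then 1 else 0)"
  proof (induction xs ys rule: list_induct2)
    case (Cons x xs y ys)
    have "(\<Sum>zs\<in>multi_indices (length (x # xs)). star (U zs (x # xs)) * U zs (y # ys))
      = (\<Sum>zs\<in>multi_indices (length xs). \<Sum>z\<in>UNIV.
          star (U zs xs) * (u $ z $ x * u $ z $ y) * U zs ys)"
      by (subst sum.swap) (simp add: sum_multi_indices_Suc star_mult star_u mult.assoc)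
    also have "\<dots> = (\<Sum>zs\<in>multi_indices (length xs).
          star (U zs xs) * (if x = y then 1 else 0) * U zs ys)"
      by (simp flip: sum_distrib_left sum_distrib_right add: orthogonal_columns)
    also have "\<dots> = (if x # xs = y # ys then 1 else 0)"
      using Cons.IH by (cases "x = y") simp_all
    finally show ?case .
  qed (simp add: multi_indices_0 cstar_one)
  with assms show ?thesis by (simp add: multi_indices_def)
qed

lemma U_coisometry:
  assumes "xs \<in> multi_indices k" "ys \<in> multi_indices k"
  shows "(\<Sum>zs\<in>multi_indices k. U xs zs * star (U ys zs)) = (if xs = ys then 1 else 0)"
proof -
  have "length xs = length ys \<Longrightarrow>
    (\<Sum>zs\<in>multi_indices (length xs). U xs zs * star (U ys zs)) = (if xs = ys then 1 else 0)"
  proof (induction xs ys rule: list_induct2)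
    case (Cons x xs y ys)
    have "(\<Sum>zs\<in>multi_indices (length (x # xs)). U (x # xs) zs * star (U (y # ys) zs))
      = (\<Sum>z\<in>UNIV. u $ x $ z * (\<Sum>zs\<in>multi_indices (length xs). U xs zs * star (U ys zs)) * u $ y $ z)"
      by (simp add: sum_multi_indices_Suc star_mult star_u mult.assoc sum_distrib_left
          sum_distrib_right)
    also have "\<dots> = (if x # xs = y # ys then 1 else 0)"
      using Cons.IH orthogonal_rows[of x y] by (cases "xs = ys") simp_all
    finally show ?case .
  qed (simp add: multi_indices_0 cstar_one)
  with assms show ?thesis by (simp add: multi_indices_def)
qed

lemma star_subalgebra_A: "cstar.subspace \<A>" "1 \<in> \<A>" "a \<in> \<A> \<Longrightarrow> b \<in> \<A> \<Longrightarrow> a * b \<in> \<A>"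
  "a \<in> \<A> \<Longrightarrow> star a \<in> \<A>"
  using star_subalgebra_cqg_algebra[of u] by (auto simp: star_subalgebra_def)

lemma u_in_A: "u $ i $ j \<in> \<A>"
  unfolding cqg_algebra_def by (rule hull_inc) blast

lemma U_in_A: "length xs = length ys \<Longrightarrow> U xs ys \<in> \<A>"
  by (induction xs ys rule: list_induct2) (auto intro: star_subalgebra_A u_in_A)

text \<open>The span of the entries is already a *-subalgebra: products of entries are entries for concatenated
words, and adjoints are entries for reversed words because the \<open>u\<^sub>i\<^sub>j\<close> are self-adjoint.\<close>

lemma A_eq_span: "\<A> = cstar.span {U xs ys | xs ys. length xs = length ys}" (is "_ = cstar.span ?B")
proof
  show "cstar.span ?B \<subseteq> \<A>"
    by (rule cstar.span_minimal) (auto intro: U_in_A star_subalgebra_A)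
  have U: "U xs ys \<in> cstar.span ?B" if "length xs = length ys" for xs ys
    using that by (intro cstar.span_base) blast
  have mult: "a * b \<in> cstar.span ?B" if "a \<in> cstar.span ?B" "b \<in> cstar.span ?B" for a b
  proof (rule clinear_span_into[OF clinear_times(1) that(1) cstar.subspace_span])
    fix c assume "c \<in> ?B"
    then obtain xs ys where c: "c = U xs ys" "length xs = length ys" by blast
    show "c * b \<in> cstar.span ?B"
    proof (rule clinear_span_into[OF clinear_times(2) that(2) cstar.subspace_span])
      fix d assume "d \<in> ?B"
      then obtain xs' ys' where d: "d = U xs' ys'" "length xs' = length ys'" by blast
      show "c * d \<in> cstar.span ?B"
        using U[of "xs @ xs'" "ys @ ys'"] c d by (simp add: U_append)
    qed
  qed
  have star: "star a \<in> cstar.span ?B" if "a \<in> cstar.span ?B" for a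
  proof -
    have "cstar.span ?B \<subseteq> {a. star a \<in> cstar.span ?B}"
    proof (rule cstar.span_minimal)
      show "cstar.subspace {a. star a \<in> cstar.span ?B}"
        by (auto simp: cstar.subspace_def star_add star_scaleC cstar_zero
            intro: cstar.span_add cstar.span_scale cstar.span_zero)
      show "?B \<subseteq> {a. star a \<in> cstar.span ?B}"
        by (auto simp: star_U intro!: U)
    qed
    with that show ?thesis by blast
  qed
  have "star_subalgebra (cstar.span ?B)"
    using U[of "[]" "[]"] mult star by (auto simp: star_subalgebra_def)
  moreover have "{u $ i $ j | i j. True} \<subseteq> cstar.span ?B"
    using U[of "[i]" "[j]" for i j] by auto
  ultimately show "\<A> \<subseteq> cstar.span ?B"
    unfolding cqg_algebra_def by (intro hull_minimal)
qed

lemma A_eqI: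
  assumes "clinear f" "clinear g" "a \<in> \<A>"
    and "\<And>k xs ys. xs \<in> multi_indices k \<Longrightarrow> ys \<in> multi_indices k \<Longrightarrow> f (U xs ys) = g (U xs ys)"
  shows "f a = g a"
  using clinear_eq_on_span[OF assms(1,2) assms(3)[unfolded A_eq_span]] assms(4)
  by (auto simp: multi_indices_def)

lemma A_into:
  assumes "clinear f" "a \<in> \<A>" "cstar.subspace W"
    and "\<And>k xs ys. xs \<in> multi_indices k \<Longrightarrow> ys \<in> multi_indices k \<Longrightarrow> f (U xs ys) \<in> W"
  shows "f a \<in> W"
  using clinear_span_into[OF assms(1) assms(2)[unfolded A_eq_span] assms(3)] assms(4)
  by (auto simp: multi_indices_def)

lemma S_in_A: "a \<in> \<A> \<Longrightarrow> S a \<in> \<A>"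
  by (rule A_into[OF S_linear _ star_subalgebra_A(1)])
    (auto simp: S_U multi_indices_def intro: star_subalgebra_A U_in_A)

lemma Delta_in_tensor_span: "a \<in> \<A> \<Longrightarrow> \<Delta> a \<in> tensor_span tens \<A> \<A>"
proof (rule A_into[OF Delta_linear _ subspace_tensor_span])
  fix k and xs ys :: "'n list" assume "xs \<in> multi_indices k" "ys \<in> multi_indices k"
  then show "\<Delta> (U xs ys) \<in> tensor_span tens \<A> \<A>"
    by (auto simp: Delta_U multi_indices_def
        intro!: cstar.subspace_sum[OF subspace_tensor_span] tensor_span_tens U_in_A)
qed

lemma Delta_star_U:
  assumes "xs \<in> multi_indices k" "ys \<in> multi_indices k"
  shows "\<Delta> (star (U xs ys)) = (\<Sum>zs\<in>multi_indices k. tens (star (U xs zs)) (star (U zs ys)))"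
  using assms by (simp add: Delta_star Delta_U cstar_sum tens_star)

end

section \<open>Fixed vectors of the Haar matrices and of the matrices of a representation\<close>

locale hopf_representation = orthogonal_hopf tens u \<Delta> \<epsilon> S
  for tens :: "'a::cstar_algebra \<Rightarrow> 'a \<Rightarrow> 't::cstar_algebra"
    and u :: "'a^'n^'n" and \<Delta> \<epsilon> S +
  fixes h :: "'a \<Rightarrow> complex"
    and \<pi> :: "'a \<Rightarrow> complex^'m^'m"
  assumes haar: "haar_functional tens \<Delta> h"
    and rep: "matrix_representation \<pi>"
begin

lemma pi_add: "\<pi> (a + b) = \<pi> a + \<pi> b"
  and pi_scale: "\<pi> (c *\<^sub>C a) = (\<chi> i j. c * \<pi> a $ i $ j)"
  and pi_mult: "\<pi> (a * b) = \<pi> a ** \<pi> b"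
  and pi_one: "\<pi> 1 = mat 1"
  and pi_star: "\<pi> (star a) = (\<chi> i j. cnj (\<pi> a $ j $ i))"
  using rep by (simp_all add: matrix_representation_def)

lemma pi_zero: "\<pi> 0 = 0"
  by (metis add_cancel_right_left pi_add)

text \<open>The normalized trace turns \<open>\<pi>\<close> into a state, and \<open>T\<^sub>k\<close> arises by applying this state to the
  entries of \<open>u\<^bsup>\<otimes>k\<^esup>\<close>.\<close>

definition \<phi> :: "'a \<Rightarrow> complex"
  where "\<phi> a = trace (\<pi> a) / of_nat CARD('m)"

lemma phi_linear: "clinear \<phi>"
  by (rule clinearI)
    (simp_all add: \<phi>_def pi_add pi_scale trace_def sum.distrib add_divide_distrib
      scaleC_complex_def flip: sum_distrib_left)

lemma phi_one: "\<phi> 1 = 1"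
  by (simp add: \<phi>_def pi_one trace_def mat_def)

lemma phi_star: "\<phi> (star a) = cnj (\<phi> a)"
  by (simp add: \<phi>_def pi_star trace_def)

lemma phi_pi_zero: "\<pi> a = 0 \<Longrightarrow> \<phi> a = 0"
  by (simp add: \<phi>_def trace_def)

lemma phi_star_mult:
  "\<phi> (star a * a) = of_real ((\<Sum>i\<in>UNIV. \<Sum>j\<in>UNIV. (cmod (\<pi> a $ i $ j))\<^sup>2) / of_nat CARD('m))"
proof -
  have "trace (\<pi> (star a * a)) = (\<Sum>j\<in>UNIV. \<Sum>i\<in>UNIV. of_real ((cmod (\<pi> a $ i $ j))\<^sup>2))"
    by (simp add: pi_mult pi_star trace_def matrix_matrix_mult_def complex_norm_square mult.commute
        del: of_real_power)
  also have "\<dots> = (\<Sum>i\<in>UNIV. \<Sum>j\<in>UNIV. of_real ((cmod (\<pi> a $ i $ j))\<^sup>2))"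
    by (rule sum.swap)
  finally show ?thesis by (simp add: \<phi>_def)
qed

lemma T_matrix_eq: "T_matrix (\<lambda>i j. \<pi> (u $ i $ j)) xs ys = \<phi> (U xs ys)"
proof -
  have "foldr (**) (map2 (\<lambda>i j. \<pi> (u $ i $ j)) xs ys) (mat 1) = \<pi> (U xs ys)"
    unfolding tensor_power_entry_def
    by (induction xs ys rule: list_induct2') (simp_all add: pi_one pi_mult)
  then show ?thesis by (simp add: T_matrix_def \<phi>_def)
qed

lemma h_linear: "clinear h" and h_one: "h 1 = 1"
  using haar by (simp_all add: haar_functional_def state_def)

lemma haar_right_slice:
  obtains E where "clinear E" "\<And>a b. E (tens a b) = h b *\<^sub>C a" "\<And>a. E (\<Delta> a) = h a *\<^sub>C 1"
proof -
  obtain E where "right_slice tens h E" "\<forall>a. E (\<Delta> a) = h a *\<^sub>C 1"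
    using haar unfolding haar_functional_def by blast
  then show thesis by (intro that[of E]) (simp_all add: right_slice_def)
qed

lemma haar_left_slice:
  obtains E where "clinear E" "\<And>a b. E (tens a b) = h a *\<^sub>C b" "\<And>a. E (\<Delta> a) = h a *\<^sub>C 1"
proof -
  obtain E where "left_slice tens h E" "\<forall>a. E (\<Delta> a) = h a *\<^sub>C 1"
    using haar unfolding haar_functional_def by blast
  then show thesis by (intro that[of E]) (simp_all add: left_slice_def)
qed

abbreviation H :: "'n list \<Rightarrow> 'n list \<Rightarrow> complex"
  where "H xs ys \<equiv> h (U xs ys)"

abbreviation T :: "'n list \<Rightarrow> 'n list \<Rightarrow> complex"
  where "T xs ys \<equiv> \<phi> (U xs ys)"

lemma right_invariance:
  assumes "xs \<in> multi_indices k" "ys \<in> multi_indices k"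
  shows "(\<Sum>zs\<in>multi_indices k. H zs ys *\<^sub>C U xs zs) = H xs ys *\<^sub>C 1"
proof -
  obtain E where E: "clinear E" "\<And>a b. E (tens a b) = h b *\<^sub>C a" "\<And>a. E (\<Delta> a) = h a *\<^sub>C 1"
    using haar_right_slice by blast
  show ?thesis
    using E(3)[of "U xs ys"] by (simp add: Delta_U[OF assms] clinear_sum[OF E(1)] E(2))
qed

lemma left_invariance:
  assumes "xs \<in> multi_indices k" "ys \<in> multi_indices k"
  shows "(\<Sum>zs\<in>multi_indices k. H xs zs *\<^sub>C U zs ys) = H xs ys *\<^sub>C 1"
proof -
  obtain E where E: "clinear E" "\<And>a b. E (tens a b) = h a *\<^sub>C b" "\<And>a. E (\<Delta> a) = h a *\<^sub>C 1"
    using haar_left_slice by blast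
  show ?thesis
    using E(3)[of "U xs ys"] by (simp add: Delta_U[OF assms] clinear_sum[OF E(1)] E(2))
qed

text \<open>For \<open>f = h\<close> this is the idempotence of \<open>H\<^sub>k = h(u\<^bsup>\<otimes>k\<^esup>)\<close>, and for \<open>f = \<phi>\<close> it is \<open>H\<^sub>k T\<^sub>k = H\<^sub>k\<close>.\<close>

lemma linear_functional_left_invariance:
  assumes "xs \<in> multi_indices k" "ys \<in> multi_indices k" and f: "clinear f" "f 1 = 1"
  shows "(\<Sum>zs\<in>multi_indices k. H xs zs * f (U zs ys)) = H xs ys"
proof -
  have "f (\<Sum>zs\<in>multi_indices k. H xs zs *\<^sub>C U zs ys) = f (H xs ys *\<^sub>C 1)"
    by (simp only: left_invariance[OF assms(1,2)])
  then show ?thesis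
    by (simp add: clinear_sum[OF f(1)] clinear_scale[OF f(1)] f(2) scaleC_complex_def)
qed

lemmas H_idempotent = linear_functional_left_invariance[OF _ _ h_linear h_one]
lemmas H_T = linear_functional_left_invariance[OF _ _ phi_linear phi_one]

text \<open>The \<open>xs\<close>-component of \<open>u\<^bsup>\<otimes>k\<^esup> v - v \<otimes> 1\<close>; it measures how far \<open>v\<close> is from being a fixed vector of
\<open>u\<^bsup>\<otimes>k\<^esup>\<close>.\<close>

definition defect :: "('n list \<Rightarrow> complex) \<Rightarrow> nat \<Rightarrow> 'n list \<Rightarrow> 'a"
  where "defect v k xs = (\<Sum>ys\<in>multi_indices k. v ys *\<^sub>C U xs ys) - v xs *\<^sub>C 1"

lemma linear_functional_defect:
  assumes "clinear f" "f 1 = 1"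
  shows "f (defect v k xs) = (\<Sum>ys\<in>multi_indices k. f (U xs ys) * v ys) - v xs"
  by (simp add: defect_def clinear_diff[OF assms(1)] clinear_sum[OF assms(1)]
      clinear_scale[OF assms(1)] assms(2) scaleC_complex_def mult.commute)

text \<open>The matrix \<open>H\<^sub>k\<close> projects onto the fixed vectors of \<open>u\<^bsup>\<otimes>k\<^esup>\<close>: applying \<open>h\<close> to \<open>u\<^bsup>\<otimes>k\<^esup> v = v\<close> gives
\<open>H\<^sub>k v = v\<close>, and right invariance, \<open>u\<^bsup>\<otimes>k\<^esup> H\<^sub>k = H\<^sub>k\<close>, shows that everything in the range of \<open>H\<^sub>k\<close> is
fixed.\<close>

lemma fixed_vectors_H_iff:
  "v \<in> fixed_vectors (multi_indices k) H \<longleftrightarrow>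
    (\<forall>xs. xs \<notin> multi_indices k \<longrightarrow> v xs = 0) \<and> (\<forall>xs\<in>multi_indices k. defect v k xs = 0)"
    (is "?l \<longleftrightarrow> ?r")
proof
  assume ?r
  then have "(\<Sum>ys\<in>multi_indices k. H xs ys * v ys) - v xs = 0" if "xs \<in> multi_indices k" for xs
    using that linear_functional_defect[OF h_linear h_one, of v k xs] clinear_zero[OF h_linear]
    by simp
  with \<open>?r\<close> show ?l by (simp add: fixed_vectors_def)
next
  assume v: ?l
  have "defect v k xs = 0" if xs: "xs \<in> multi_indices k" for xs
  proof -
    have "(\<Sum>ys\<in>multi_indices k. v ys *\<^sub>C U xs ys)
      = (\<Sum>ys\<in>multi_indices k. \<Sum>zs\<in>multi_indices k. v zs *\<^sub>C H ys zs *\<^sub>C U xs ys)"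
    proof (rule sum.cong[OF refl])
      fix ys :: "'n list" assume "ys \<in> multi_indices k"
      then have "v ys = (\<Sum>zs\<in>multi_indices k. H ys zs * v zs)"
        using v by (simp add: fixed_vectors_def)
      then show "v ys *\<^sub>C U xs ys = (\<Sum>zs\<in>multi_indices k. v zs *\<^sub>C H ys zs *\<^sub>C U xs ys)"
        by (simp add: cstar.scale_sum_left scaleC_scaleC mult.commute)
    qed
    also have "\<dots> = (\<Sum>zs\<in>multi_indices k. v zs *\<^sub>C (\<Sum>ys\<in>multi_indices k. H ys zs *\<^sub>C U xs ys))"
      by (subst sum.swap) (simp add: cstar.scale_sum_right)
    also have "\<dots> = (\<Sum>zs\<in>multi_indices k. v zs *\<^sub>C H xs zs *\<^sub>C 1)"
      using right_invariance[OF xs] by (intro sum.cong) auto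
    also have "\<dots> = (\<Sum>zs\<in>multi_indices k. H xs zs * v zs) *\<^sub>C 1"
      by (simp add: cstar.scale_sum_left scaleC_scaleC mult.commute)
    also have "\<dots> = v xs *\<^sub>C 1"
      using v xs by (simp add: fixed_vectors_def)
    finally show ?thesis by (simp add: defect_def)
  qed
  with v show ?r by (simp add: fixed_vectors_def)
qed

lemma fixed_vectors_T_if_pi_defect_zero:
  assumes "\<And>xs. xs \<notin> multi_indices k \<Longrightarrow> v xs = 0"
    and "\<And>xs. xs \<in> multi_indices k \<Longrightarrow> \<pi> (defect v k xs) = 0"
  shows "v \<in> fixed_vectors (multi_indices k) T"
  using assms phi_pi_zero linear_functional_defect[OF phi_linear phi_one, of v k]
  by (fastforce simp: fixed_vectors_def)

lemma fixed_vectors_H_subset_T: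
  "fixed_vectors (multi_indices k) H \<subseteq> fixed_vectors (multi_indices k) T"
  by (auto simp: fixed_vectors_H_iff pi_zero intro: fixed_vectors_T_if_pi_defect_zero)

text \<open>The equality case of the Cauchy-Schwarz inequality. With \<open>y = u\<^bsup>\<otimes>k\<^esup> v - v\<close>, unitarity of \<open>u\<^bsup>\<otimes>k\<^esup>\<close>
gives \<open>\<Sum> \<phi>(y\<^sub>x\<^sup>* y\<^sub>x) = 2 \<parallel>v\<parallel>\<^sup>2 - 2 Re \<langle>v, T\<^sub>k v\<rangle>\<close>, which is \<open>0\<close> if \<open>T\<^sub>k v = v\<close>. As the trace on matrices
is faithful, every \<open>\<pi>(y\<^sub>x)\<close> vanishes.\<close>

lemma pi_defect_zero:
  assumes v: "v \<in> fixed_vectors (multi_indices k) T" and xs: "xs \<in> multi_indices k"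
  shows "\<pi> (defect v k xs) = 0"
proof -
  let ?I = "multi_indices k :: 'n list set"
  define a where "a xs = (\<Sum>ys\<in>?I. v ys *\<^sub>C U xs ys)" for xs
  define N where "N = (\<Sum>xs\<in>?I. cnj (v xs) * v xs)"
  define q where "q x = (\<Sum>i\<in>UNIV. \<Sum>j\<in>UNIV. (cmod (\<pi> x $ i $ j))\<^sup>2)" for x
  note phi = clinear_sum[OF phi_linear] clinear_scale[OF phi_linear] clinear_diff[OF phi_linear]
    clinear_add[OF phi_linear]
  have phi_a: "\<phi> (a xs) = v xs" if "xs \<in> ?I" for xs
    using v that by (simp add: a_def phi fixed_vectors_def scaleC_complex_def mult.commute)
  \<comment> \<open>\<open>\<parallel>u\<^bsup>\<otimes>k\<^esup> v\<parallel>\<^sup>2 = \<parallel>v\<parallel>\<^sup>2\<close>\<close>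
  have "(\<Sum>xs\<in>?I. star (a xs) * a xs)
    = (\<Sum>xs\<in>?I. \<Sum>ys\<in>?I. \<Sum>zs\<in>?I. (cnj (v ys) * v zs) *\<^sub>C (star (U xs ys) * U xs zs))"
    by (simp add: a_def cstar_sum star_scaleC sum_product mult_scaleC_left mult_scaleC_right
        scaleC_scaleC mult.commute)
  also have "\<dots> = (\<Sum>ys\<in>?I. \<Sum>xs\<in>?I. \<Sum>zs\<in>?I. (cnj (v ys) * v zs) *\<^sub>C (star (U xs ys) * U xs zs))"
    by (rule sum.swap)
  also have "\<dots> = (\<Sum>ys\<in>?I. \<Sum>zs\<in>?I. (cnj (v ys) * v zs) *\<^sub>C (\<Sum>xs\<in>?I. star (U xs ys) * U xs zs))"
    by (rule sum.cong[OF refl], subst sum.swap) (simp add: cstar.scale_sum_right)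
  also have "\<dots> = (\<Sum>ys\<in>?I. \<Sum>zs\<in>?I. if ys = zs then (cnj (v ys) * v zs) *\<^sub>C 1 else 0)"
    by (intro sum.cong refl) (simp add: U_isometry)
  also have "\<dots> = N *\<^sub>C 1"
    by (simp add: sum.delta' finite_multi_indices N_def cstar.scale_sum_left)
  finally have aa: "(\<Sum>xs\<in>?I. \<phi> (star (a xs) * a xs)) = N"
    by (simp add: phi phi_one scaleC_complex_def flip: clinear_sum[OF phi_linear])
  have "(\<Sum>xs\<in>?I. \<phi> (star (defect v k xs) * defect v k xs))
    = (\<Sum>xs\<in>?I. \<phi> (star (a xs) * a xs) - cnj (v xs) * v xs)"
  proof (rule sum.cong[OF refl])
    fix xs assume xs: "xs \<in> ?I"
    have "star (defect v k xs) * defect v k xs = star (a xs) * a xs - v xs *\<^sub>C star (a xs)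
        - cnj (v xs) *\<^sub>C a xs + (cnj (v xs) * v xs) *\<^sub>C 1"
      by (simp add: defect_def a_def[symmetric] cstar_diff star_scaleC cstar_one left_diff_distrib
          right_diff_distrib mult_scaleC_left mult_scaleC_right scaleC_scaleC mult.commute
          cstar.scale_right_diff_distrib)
    then show "\<phi> (star (defect v k xs) * defect v k xs) = \<phi> (star (a xs) * a xs) - cnj (v xs) * v xs"
      by (simp add: phi phi_star phi_a[OF xs] phi_one scaleC_complex_def)
  qed
  also have "\<dots> = 0"
    by (simp add: sum_subtractf aa N_def)
  finally have "of_real (\<Sum>xs\<in>?I. q (defect v k xs) / of_nat CARD('m)) = (0 :: complex)"
    by (simp add: phi_star_mult q_def)
  then have "(\<Sum>xs\<in>?I. q (defect v k xs) / of_nat CARD('m)) = 0"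
    by (simp only: of_real_eq_0_iff)
  moreover have q_nonneg: "0 \<le> q x" for x
    unfolding q_def by (intro sum_nonneg) auto
  ultimately have "q (defect v k xs) = 0"
    using xs by (subst (asm) sum_nonneg_eq_0_iff) (auto simp: finite_multi_indices)
  then have "cmod (\<pi> (defect v k xs) $ i $ j) = 0" for i j
    unfolding q_def by (simp add: sum_nonneg_eq_0_iff sum_nonneg)
  then show ?thesis by (simp add: vec_eq_iff)
qed

text \<open>Since \<open>\<chi>\<^sup>k\<close> is the trace of \<open>u\<^bsup>\<otimes>k\<^esup>\<close>, its Haar integral is the trace of the idempotent \<open>H\<^sub>k\<close>.\<close>

lemma haar_character_power:
  "h (trace u ^ k) = of_nat (eigenvalue_multiplicity (multi_indices k) H 1)"
proof -
  have "h (trace u ^ k) = (\<Sum>xs\<in>multi_indices k. H xs xs)"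
    by (simp add: trace_power_eq clinear_sum[OF h_linear])
  also have "\<dots> = of_nat (eigenvalue_multiplicity (multi_indices k) H 1)"
    by (rule trace_idempotent) (auto simp: finite_multi_indices H_idempotent)
  finally show ?thesis .
qed

text \<open>A fixed vector of \<open>u\<^bsup>\<otimes>k\<^esup>\<close> is always fixed by \<open>T\<^sub>k\<close>, so the inequality between the dimensions can only
hold with equality.\<close>

lemma multiplicity_le_iff:
  "of_nat (eigenvalue_multiplicity (multi_indices k) T 1) \<le> h (trace u ^ k) \<longleftrightarrow>
    fixed_vectors (multi_indices k) T = fixed_vectors (multi_indices k) H"
proof -
  have "of_nat (eigenvalue_multiplicity (multi_indices k) T 1) \<le> h (trace u ^ k) \<longleftrightarrow>
    eigenvalue_multiplicity (multi_indices k) T 1 \<le> eigenvalue_multiplicity (multi_indices k) H 1"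
    by (simp add: haar_character_power less_eq_complex_def)
  then show ?thesis
    using fixed_vectors_eq_if_dim_le[OF finite_multi_indices fixed_vectors_H_subset_T]
    by (auto simp: eigenvalue_multiplicity_1)
qed

section \<open>The Hopf ideal generated by the fixed vectors\<close>

definition defects :: "'a set"
  where "defects = {defect v k xs | v k xs.
    v \<in> fixed_vectors (multi_indices k) T \<and> xs \<in> multi_indices k}"

lemma defects_in_A: "g \<in> defects \<Longrightarrow> g \<in> \<A>"
  by (auto simp: defects_def defect_def multi_indices_def
      intro!: cstar.subspace_diff[OF star_subalgebra_A(1)] cstar.subspace_sum[OF star_subalgebra_A(1)]
        cstar.subspace_scale[OF star_subalgebra_A(1)] U_in_A star_subalgebra_A(2))

text \<open>The adjoint of \<open>u\<^bsup>\<otimes>k\<^esup> v - v\<close> is, up to reversal of words, the defect of the conjugate vector \<open>w\<close>.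
That \<open>w\<close> is again fixed by \<open>T\<^sub>k\<close> follows because \<open>\<pi>\<close> kills the adjoints of the defects of \<open>v\<close>.\<close>

lemma defects_star:
  assumes "g \<in> defects"
  shows "star g \<in> defects"
proof -
  obtain v k xs where g: "g = defect v k xs" "v \<in> fixed_vectors (multi_indices k) T"
    "xs \<in> multi_indices k"
    using assms by (auto simp: defects_def)
  define w where "w ys = cnj (v (rev ys))" for ys
  have eq: "star (defect v k xs) = defect w k (rev xs)" if "xs \<in> multi_indices k" for xs
  proof -
    have "bij_betw rev (multi_indices k) (multi_indices k :: 'n list set)"
      by (rule bij_betwI[of _ _ _ rev]) (auto simp: multi_indices_def)
    then have "(\<Sum>ys\<in>multi_indices k. w ys *\<^sub>C U (rev xs) ys)
      = (\<Sum>ys\<in>multi_indices k. w (rev ys) *\<^sub>C U (rev xs) (rev ys))"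
      by (rule sum.reindex_bij_betw[symmetric])
    also have "\<dots> = star (\<Sum>ys\<in>multi_indices k. v ys *\<^sub>C U xs ys)"
      unfolding cstar_sum star_scaleC using that
      by (intro sum.cong) (auto simp: w_def star_U multi_indices_def)
    finally show ?thesis
      by (simp add: defect_def cstar_diff star_scaleC cstar_one w_def)
  qed
  have "w \<in> fixed_vectors (multi_indices k) T"
  proof (rule fixed_vectors_T_if_pi_defect_zero)
    fix ys :: "'n list" assume "ys \<notin> multi_indices k"
    then show "w ys = 0" using g(2) by (simp add: w_def fixed_vectors_def multi_indices_def)
  next
    fix ys :: "'n list" assume "ys \<in> multi_indices k"
    then have "rev ys \<in> multi_indices k" by (simp add: multi_indices_def)
    with eq[OF this] pi_defect_zero[OF g(2) this] show "\<pi> (defect w k ys) = 0"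
      by (metis (no_types, lifting) pi_star rev_rev_ident vec_eq_iff vec_lambda_beta zero_index
          complex_cnj_zero)
  qed
  moreover have "rev xs \<in> multi_indices k" using g(3) by (simp add: multi_indices_def)
  ultimately show ?thesis
    using eq[OF g(3)] g(1) by (auto simp: defects_def)
qed


definition defect_ideal :: "'a set"
  where "defect_ideal = cstar.span {a * g * b | a g b. a \<in> \<A> \<and> g \<in> defects \<and> b \<in> \<A>}"

lemma defect_ideal_into:
  assumes "clinear f" "x \<in> defect_ideal" "cstar.subspace W"
    and "\<And>a g b. a \<in> \<A> \<Longrightarrow> g \<in> defects \<Longrightarrow> b \<in> \<A> \<Longrightarrow> f (a * g * b) \<in> W"
  shows "f x \<in> W"
  using clinear_span_into[OF assms(1) assms(2)[unfolded defect_ideal_def] assms(3)] assms(4)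
  by blast

lemma subspace_defect_ideal: "cstar.subspace defect_ideal"
  by (simp add: defect_ideal_def)

lemma defect_ideal_base: "a \<in> \<A> \<Longrightarrow> g \<in> defects \<Longrightarrow> b \<in> \<A> \<Longrightarrow> a * g * b \<in> defect_ideal"
  unfolding defect_ideal_def by (intro cstar.span_base) blast

lemma defects_in_ideal: "g \<in> defects \<Longrightarrow> g \<in> defect_ideal"
  using defect_ideal_base[of 1 g 1] star_subalgebra_A(2) by simp

lemma defect_ideal_mult:
  assumes "c \<in> \<A>" "x \<in> defect_ideal"
  shows "c * x \<in> defect_ideal" "x * c \<in> defect_ideal"
  using defect_ideal_base assms(1) star_subalgebra_A(3)
  by (intro defect_ideal_into[OF clinear_times(2) assms(2) subspace_defect_ideal]
      defect_ideal_into[OF clinear_times(1) assms(2) subspace_defect_ideal];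
      metis mult.assoc)+

text \<open>Multiplying the defect by \<open>S(u\<^bsup>\<otimes>k\<^esup>) = (u\<^bsup>\<otimes>k\<^esup>)\<^sup>-\<^sup>1\<close> gives \<open>S(u\<^bsup>\<otimes>k\<^esup>) (u\<^bsup>\<otimes>k\<^esup> v - v) = v - S(u\<^bsup>\<otimes>k\<^esup>) v\<close>.\<close>

lemma S_defects: "g \<in> defects \<Longrightarrow> S g \<in> defect_ideal"
proof -
  assume "g \<in> defects"
  then obtain v k xs where g: "g = defect v k xs" "v \<in> fixed_vectors (multi_indices k) T"
    "xs \<in> multi_indices k"
    by (auto simp: defects_def)
  let ?I = "multi_indices k :: 'n list set"
  have d: "defect v k ys \<in> defects" if "ys \<in> ?I" for ys
    using g(2) that by (auto simp: defects_def)
  have "(\<Sum>ys\<in>?I. star (U ys xs) * defect v k ys)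
    = (\<Sum>ys\<in>?I. \<Sum>zs\<in>?I. v zs *\<^sub>C (star (U ys xs) * U ys zs)) - (\<Sum>ys\<in>?I. v ys *\<^sub>C star (U ys xs))"
    by (simp add: defect_def right_diff_distrib sum_subtractf sum_distrib_left mult_scaleC_right)
  also have "(\<Sum>ys\<in>?I. \<Sum>zs\<in>?I. v zs *\<^sub>C (star (U ys xs) * U ys zs))
    = (\<Sum>zs\<in>?I. v zs *\<^sub>C (\<Sum>ys\<in>?I. star (U ys xs) * U ys zs))"
    by (subst sum.swap) (simp add: cstar.scale_sum_right)
  also have "\<dots> = (\<Sum>zs\<in>?I. if xs = zs then v zs *\<^sub>C 1 else 0)"
    using g(3) by (intro sum.cong refl) (simp add: U_isometry)
  also have "\<dots> = v xs *\<^sub>C 1"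
    using g(3) by (simp add: finite_multi_indices)
  also have "(\<Sum>ys\<in>?I. v ys *\<^sub>C star (U ys xs)) = (\<Sum>ys\<in>?I. v ys *\<^sub>C S (U xs ys))"
    using g(3) by (intro sum.cong) (auto simp: S_U multi_indices_def)
  finally have "S g = - (\<Sum>ys\<in>?I. star (U ys xs) * defect v k ys)"
    unfolding g(1) defect_def[of v k xs]
    by (simp add: clinear_diff[OF S_linear] clinear_sum[OF S_linear] clinear_scale[OF S_linear] S_one)
  also have "\<dots> \<in> defect_ideal"
    using g(3)
    by (intro cstar.subspace_neg[OF subspace_defect_ideal]
        cstar.subspace_sum[OF subspace_defect_ideal] defect_ideal_mult(1) defects_in_ideal d
        star_subalgebra_A(4) U_in_A)
      (auto simp: multi_indices_def)
  finally show ?thesis .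
qed

text \<open>For \<open>d = u\<^bsup>\<otimes>k\<^esup> v - v\<close>, comultiplicativity of \<open>u\<^bsup>\<otimes>k\<^esup>\<close> gives
\<open>\<Delta>(d\<^sub>x) = d\<^sub>x \<otimes> 1 + \<Sum>\<^sub>z u\<^sub>x\<^sub>z \<otimes> d\<^sub>z\<close>.\<close>

lemma Delta_defects:
  assumes "g \<in> defects"
  obtains y z where "\<Delta> g = y + z" "y \<in> tensor_span tens defect_ideal \<A>"
    "z \<in> tensor_span tens \<A> defect_ideal"
proof -
  obtain v k xs where g: "g = defect v k xs" "v \<in> fixed_vectors (multi_indices k) T"
    "xs \<in> multi_indices k"
    using assms by (auto simp: defects_def)
  let ?I = "multi_indices k :: 'n list set"
  have d: "defect v k ys \<in> defects" if "ys \<in> ?I" for ys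
    using g(2) that by (auto simp: defects_def)
  have "(\<Sum>zs\<in>?I. tens (U xs zs) (defect v k zs))
    = (\<Sum>zs\<in>?I. \<Sum>ys\<in>?I. v ys *\<^sub>C tens (U xs zs) (U zs ys)) - (\<Sum>zs\<in>?I. v zs *\<^sub>C tens (U xs zs) 1)"
    by (simp add: defect_def tens_simps sum_subtractf)
  also have "(\<Sum>zs\<in>?I. \<Sum>ys\<in>?I. v ys *\<^sub>C tens (U xs zs) (U zs ys))
    = (\<Sum>ys\<in>?I. v ys *\<^sub>C \<Delta> (U xs ys))"
    by (subst sum.swap) (simp add: cstar.scale_sum_right Delta_U[OF g(3)])
  also have "(\<Sum>zs\<in>?I. v zs *\<^sub>C tens (U xs zs) 1) = tens g 1 + v xs *\<^sub>C 1"
    by (simp add: g(1) defect_def tens_simps tens_one)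
  finally have "\<Delta> g = tens g 1 + (\<Sum>zs\<in>?I. tens (U xs zs) (defect v k zs))"
    unfolding g(1) defect_def[of v k xs]
    by (simp add: clinear_diff[OF Delta_linear] clinear_sum[OF Delta_linear]
        clinear_scale[OF Delta_linear] Delta_one)
  moreover have "tens g 1 \<in> tensor_span tens defect_ideal \<A>"
    using assms by (intro tensor_span_tens defects_in_ideal star_subalgebra_A(2))
  moreover have "(\<Sum>zs\<in>?I. tens (U xs zs) (defect v k zs)) \<in> tensor_span tens \<A> defect_ideal"
    using g(3)
    by (intro cstar.subspace_sum[OF subspace_tensor_span] tensor_span_tens defects_in_ideal U_in_A d)
      (auto simp: multi_indices_def)
  ultimately show thesis by (rule that)
qed

lemma pi_defect_ideal:
  assumes "x \<in> defect_ideal"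
  shows "\<pi> x = 0"
proof -
  have "cstar.subspace {x. \<pi> x = 0}"
    by (auto simp: cstar.subspace_def pi_add pi_scale pi_zero vec_eq_iff)
  moreover have "a * g * b \<in> {x. \<pi> x = 0}" if "g \<in> defects" for a g b
    using that by (auto simp: defects_def pi_mult pi_defect_zero)
  ultimately have "defect_ideal \<subseteq> {x. \<pi> x = 0}"
    unfolding defect_ideal_def by (intro cstar.span_minimal) blast+
  with assms show ?thesis by blast
qed

lemma hopf_star_ideal_defect_ideal: "hopf_star_ideal tens u \<Delta> \<epsilon> S defect_ideal"
proof -
  let ?J = defect_ideal
  have clinear_id: "clinear (\<lambda>x :: 'a. x)"
    by (rule clinearI) auto
  have sub: "?J \<subseteq> \<A>"
    using defect_ideal_into[OF clinear_id _ star_subalgebra_A(1)] star_subalgebra_A(3) defects_in_A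
    by blast
  have star: "star x \<in> ?J" if "x \<in> ?J" for x
  proof -
    have "cstar.subspace {x. star x \<in> ?J}"
      using subspace_defect_ideal
      by (auto simp: cstar.subspace_def star_add star_scaleC cstar_zero)
    moreover have "star (a * g * b) \<in> ?J" if "a \<in> \<A>" "g \<in> defects" "b \<in> \<A>" for a g b
      using defect_ideal_base[of "star b" "star g" "star a"] that defects_star star_subalgebra_A(4)
      by (simp add: star_mult mult.assoc)
    ultimately have "cstar.span {a * g * b | a g b. a \<in> \<A> \<and> g \<in> defects \<and> b \<in> \<A>}
        \<subseteq> {x. star x \<in> ?J}"
      by (intro cstar.span_minimal) blast+
    with that show ?thesis by (auto simp flip: defect_ideal_def)
  qed
  have eps: "\<epsilon> x = 0" if "x \<in> ?J" for x
  proof -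
    have "\<epsilon> g = 0" if "g \<in> defects" for g
    proof -
      from that obtain v k xs where g: "g = defect v k xs" "v \<in> fixed_vectors (multi_indices k) T"
        "xs \<in> multi_indices k"
        by (auto simp: defects_def)
      have "(\<Sum>ys\<in>multi_indices k. \<epsilon> (U xs ys) * v ys)
        = (\<Sum>ys\<in>multi_indices k. if xs = ys then v ys else 0)"
        using g(3) by (intro sum.cong) (auto simp: eps_U multi_indices_def)
      with g(3) show ?thesis
        by (simp add: g(1) linear_functional_defect[OF eps_linear eps_one] finite_multi_indices)
    qed
    then have "\<epsilon> x \<in> {0}"
      by (intro defect_ideal_into[OF eps_linear that])
        (auto simp: eps_mult cstar.subspace_def)
    then show ?thesis by simp
  qed
  have S: "S x \<in> ?J" if "x \<in> ?J" for x
    by (rule defect_ideal_into[OF S_linear that subspace_defect_ideal])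
      (simp add: S_mult defect_ideal_mult S_defects S_in_A)
  let ?X = "{y + z | y z. y \<in> tensor_span tens ?J \<A> \<and> z \<in> tensor_span tens \<A> ?J}"
  have Delta: "\<Delta> x \<in> ?X" if "x \<in> ?J" for x
  proof (rule defect_ideal_into[OF Delta_linear that])
    show "cstar.subspace ?X"
      by (rule cstar.subspace_sums) (rule subspace_tensor_span)+
    fix a g b assume agb: "a \<in> \<A>" "g \<in> defects" "b \<in> \<A>"
    obtain y z where yz: "\<Delta> g = y + z" "y \<in> tensor_span tens ?J \<A>" "z \<in> tensor_span tens \<A> ?J"
      using Delta_defects[OF agb(2)] .
    note ab = Delta_in_tensor_span[OF agb(1)] Delta_in_tensor_span[OF agb(3)]
    have "\<Delta> a * y \<in> tensor_span tens ?J \<A>" "\<Delta> a * z \<in> tensor_span tens \<A> ?J"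
      using tensor_span_mult[OF ab(1) yz(2)] tensor_span_mult[OF ab(1) yz(3)]
        defect_ideal_mult(1) star_subalgebra_A(3) by blast+
    then have "\<Delta> a * y * \<Delta> b \<in> tensor_span tens ?J \<A>" "\<Delta> a * z * \<Delta> b \<in> tensor_span tens \<A> ?J"
      using tensor_span_mult[OF _ ab(2)] defect_ideal_mult(2) star_subalgebra_A(3) by blast+
    moreover have "\<Delta> (a * g * b) = \<Delta> a * y * \<Delta> b + \<Delta> a * z * \<Delta> b"
      by (simp add: Delta_mult yz(1) distrib_left distrib_right)
    ultimately show "\<Delta> (a * g * b) \<in> ?X" by blast
  qed
  show ?thesis
    unfolding hopf_star_ideal_def
    by (intro conjI ballI sub subspace_defect_ideal defect_ideal_mult star Delta eps S)
qed

lemma inner_faithful_iff: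
  "inner_faithful tens u \<Delta> \<epsilon> S \<pi> \<longleftrightarrow> hopf_image_ideal tens u \<Delta> \<epsilon> S \<pi> = {0}"
proof -
  define J where "J = hopf_image_ideal tens u \<Delta> \<epsilon> S \<pi>"
  define R where "R = ideal_rel \<A> J"
  have "hopf_star_ideal tens u \<Delta> \<epsilon> S J"
    using hopf_image_ideal_greatest(1)[OF hopf rep] by (simp add: J_def)
  then have J: "J \<subseteq> \<A>" "cstar.subspace J"
    by (simp_all add: hopf_star_ideal_def)
  have cls: "R `` {a} = {b \<in> \<A>. a - b \<in> J}" if "a \<in> \<A>" for a
    using that by (auto simp: R_def ideal_rel_def)
  have "inner_faithful tens u \<Delta> \<epsilon> S \<pi> \<longleftrightarrow> inj_on (\<lambda>a. R `` {a}) \<A>"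
    by (auto simp: inner_faithful_def Let_def bij_betw_def quotient_def R_def J_def)
  also have "\<dots> \<longleftrightarrow> J = {0}"
  proof
    assume inj: "inj_on (\<lambda>a. R `` {a}) \<A>"
    have "x = 0" if "x \<in> J" for x
    proof -
      have "x - b \<in> J \<longleftrightarrow> 0 - b \<in> J" for b
        using cstar.subspace_diff[OF J(2) _ that, of "x - b"]
          cstar.subspace_add[OF J(2) that, of "0 - b"] by auto
      then have "R `` {x} = R `` {0}"
        using cls[of x] cls[of 0] that J(1) cstar.subspace_0[OF star_subalgebra_A(1)] by auto
      then show ?thesis
        using inj that J(1) cstar.subspace_0[OF star_subalgebra_A(1)] by (auto dest: inj_onD)
    qed
    then show "J = {0}" using cstar.subspace_0[OF J(2)] by blast
  next
    assume "J = {0}"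
    then have "R `` {a} = {a}" if "a \<in> \<A>" for a
      using cls[OF that] that by auto
    then show "inj_on (\<lambda>a. R `` {a}) \<A>" by (simp add: inj_on_def)
  qed
  finally show ?thesis by (simp add: J_def)
qed

text \<open>The ideal generated by the defects is a Hopf *-ideal in the kernel of \<open>\<pi>\<close>. Inner faithfulness makes
it zero, so that every vector fixed by \<open>T\<^sub>k\<close> is fixed by \<open>u\<^bsup>\<otimes>k\<^esup>\<close>.\<close>

lemma fixed_vectors_eq_if_inner_faithful:
  assumes "inner_faithful tens u \<Delta> \<epsilon> S \<pi>"
  shows "fixed_vectors (multi_indices k) T = fixed_vectors (multi_indices k) H"
proof
  have "defect_ideal \<subseteq> {a \<in> \<A>. \<pi> a = 0}"
    using hopf_star_ideal_defect_ideal pi_defect_ideal by (auto simp: hopf_star_ideal_def)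
  then have "defect_ideal \<subseteq> {0}"
    using hopf_image_ideal_greatest(2)[OF hopf rep] hopf_star_ideal_defect_ideal assms
    by (simp add: inner_faithful_iff)
  then have "g = 0" if "g \<in> defects" for g
    using defects_in_ideal that by blast
  then show "fixed_vectors (multi_indices k) T \<subseteq> fixed_vectors (multi_indices k) H"
    by (auto simp: fixed_vectors_H_iff defects_def) (auto simp: fixed_vectors_def)
qed (rule fixed_vectors_H_subset_T)

section \<open>Vanishing of the Haar functional on Hopf ideals inside the kernel\<close>

text \<open>A filtration of the CQG-algebra by finite-dimensional subspaces that are invariant under convolution
operators \<open>(id \<otimes> f) \<Delta>\<close>.\<close>

definition length_filtration :: "nat \<Rightarrow> 'a set"
  where "length_filtration N = cstar.span {U xs ys | xs ys. length xs = length ys \<and> length ys \<le> N}"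

lemma U_in_filtration:
  assumes "xs \<in> multi_indices k" "ys \<in> multi_indices k" "k \<le> N"
  shows "U xs ys \<in> length_filtration N"
proof -
  have "length xs = length ys \<and> length ys \<le> N" using assms by (simp add: multi_indices_def)
  then show ?thesis unfolding length_filtration_def by (intro cstar.span_base) blast
qed

lemma subspace_filtration: "cstar.subspace (length_filtration N)"
  by (simp add: length_filtration_def)

lemma filtration_into:
  assumes "clinear f" "a \<in> length_filtration N" "cstar.subspace W"
    and "\<And>k xs ys. k \<le> N \<Longrightarrow> xs \<in> multi_indices k \<Longrightarrow> ys \<in> multi_indices k \<Longrightarrow> f (U xs ys) \<in> W"
  shows "f a \<in> W"
  using clinear_span_into[OF assms(1) assms(2)[unfolded length_filtration_def] assms(3)] assms(4)
  by (auto simp: multi_indices_def)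

lemma filtration_finitely_spanned:
  obtains B where "finite B" "length_filtration N = cstar.span B"
proof
  let ?I = "\<Union>k\<le>N. multi_indices k :: 'n list set"
  have "{U xs ys | xs ys. length xs = length ys \<and> length ys \<le> N} \<subseteq> (\<lambda>(xs, ys). U xs ys) ` (?I \<times> ?I)"
    by (auto simp: multi_indices_def)
  then show "finite {U xs ys | xs ys. length xs = length ys \<and> length ys \<le> N}"
    by (rule finite_subset) (simp add: finite_multi_indices)
qed (rule length_filtration_def)

lemma A_in_filtration:
  assumes "a \<in> \<A>"
  obtains N where "a \<in> length_filtration N"
proof -
  have mono: "length_filtration M \<subseteq> length_filtration N" if "M \<le> N" for M N
    unfolding length_filtration_def using that by (intro cstar.span_mono) (blast intro: le_trans)
  have "cstar.subspace {a. \<exists>N. a \<in> length_filtration N}"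
    unfolding cstar.subspace_def
  proof (intro conjI allI ballI)
    fix x y assume "x \<in> {a. \<exists>N. a \<in> length_filtration N}" "y \<in> {a. \<exists>N. a \<in> length_filtration N}"
    then obtain M N where "x \<in> length_filtration M" "y \<in> length_filtration N" by blast
    then have "x + y \<in> length_filtration (max M N)"
      using mono[of M "max M N"] mono[of N "max M N"]
      by (intro cstar.subspace_add[OF subspace_filtration]) auto
    then show "x + y \<in> {a. \<exists>N. a \<in> length_filtration N}" by blast
  qed (auto intro: cstar.subspace_0[OF subspace_filtration]
      cstar.subspace_scale[OF subspace_filtration])
  moreover have "clinear (\<lambda>x :: 'a. x)"
    by (rule clinearI) auto
  ultimately have "a \<in> {a. \<exists>N. a \<in> length_filtration N}"
    using A_into[of "\<lambda>x. x" a, OF _ assms] U_in_filtration by blast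
  with that show thesis by blast
qed

text \<open>The matrix \<open>1 - T\<^sub>k + H\<^sub>k\<close> is injective, hence onto. If it kills \<open>v\<close>, multiplication by \<open>H\<^sub>k\<close> together with
\<open>H\<^sub>k T\<^sub>k = H\<^sub>k = H\<^sub>k\<^sup>2\<close> yields \<open>H\<^sub>k v = 0\<close>, hence \<open>T\<^sub>k v = v\<close>; by assumption then \<open>v = H\<^sub>k v = 0\<close>.\<close>

lemma one_minus_T_plus_H_surjective:
  assumes fixed: "fixed_vectors (multi_indices k) T = fixed_vectors (multi_indices k) H"
    and ys: "ys \<in> multi_indices k"
  obtains w where "\<And>zs. zs \<in> multi_indices k \<Longrightarrow>
    w zs - (\<Sum>ws\<in>multi_indices k. T zs ws * w ws) + (\<Sum>ws\<in>multi_indices k. H zs ws * w ws)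
      = (if zs = ys then 1 else 0)"
proof -
  let ?I = "multi_indices k :: 'n list set"
  define W where "W = {v :: 'n list \<Rightarrow> complex. \<forall>zs. zs \<notin> ?I \<longrightarrow> v zs = 0}"
  define f where "f v zs = (if zs \<in> ?I then
    v zs - (\<Sum>ws\<in>?I. T zs ws * v ws) + (\<Sum>ws\<in>?I. H zs ws * v ws) else 0)" for v zs
  have "f ` W = W"
  proof (rule injective_imp_surjective_on_subspace)
    show "Vector_Spaces.linear (\<lambda>c (v :: 'n list \<Rightarrow> complex) zs. c * v zs) (\<lambda>c v zs. c * v zs) f"
      by (simp add: Vector_Spaces.linear_iff cfun.vector_space_axioms)
        (auto simp: f_def fun_eq_iff algebra_simps sum.distrib sum_distrib_left)
    show "cfun.subspace W" by (auto simp: W_def cfun.subspace_def)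
    show "W \<subseteq> cfun.span ((\<lambda>i k. if k = i then 1 else 0) ` ?I)"
      using supported_in_span[OF finite_multi_indices] by (auto simp: W_def)
    show "finite ((\<lambda>i k. if k = i then 1 else 0 :: complex) ` ?I)"
      by (simp add: finite_multi_indices)
    show "f ` W \<subseteq> W" by (auto simp: W_def f_def)
    fix v assume v: "v \<in> W" "f v = 0"
    have *: "v zs - (\<Sum>ws\<in>?I. T zs ws * v ws) + (\<Sum>ws\<in>?I. H zs ws * v ws) = 0" if "zs \<in> ?I" for zs
      using that fun_cong[OF v(2), of zs] by (simp add: f_def)
    have Hv: "(\<Sum>ws\<in>?I. H xs ws * v ws) = 0" if xs: "xs \<in> ?I" for xs
    proof -
      have HM: "(\<Sum>zs\<in>?I. H xs zs * (\<Sum>ws\<in>?I. M zs ws * v ws)) = (\<Sum>ws\<in>?I. H xs ws * v ws)"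
        if "\<And>ws. ws \<in> ?I \<Longrightarrow> (\<Sum>zs\<in>?I. H xs zs * M zs ws) = H xs ws" for M
      proof -
        have "(\<Sum>zs\<in>?I. H xs zs * (\<Sum>ws\<in>?I. M zs ws * v ws))
          = (\<Sum>ws\<in>?I. (\<Sum>zs\<in>?I. H xs zs * M zs ws) * v ws)"
          unfolding sum_distrib_left sum_distrib_right by (subst sum.swap) (simp add: mult.assoc)
        then show ?thesis using that by simp
      qed
      have "0 = (\<Sum>zs\<in>?I. H xs zs *
          (v zs - (\<Sum>ws\<in>?I. T zs ws * v ws) + (\<Sum>ws\<in>?I. H zs ws * v ws)))"
        using * by simp
      also have "\<dots> = (\<Sum>zs\<in>?I. H xs zs * v zs) - (\<Sum>zs\<in>?I. H xs zs * (\<Sum>ws\<in>?I. T zs ws * v ws))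
          + (\<Sum>zs\<in>?I. H xs zs * (\<Sum>ws\<in>?I. H zs ws * v ws))"
        by (simp only: distrib_left right_diff_distrib sum.distrib sum_subtractf)
      also have "\<dots> = (\<Sum>ws\<in>?I. H xs ws * v ws)"
        using HM[of T] HM[of H] H_T[OF xs] H_idempotent[OF xs] by simp
      finally show ?thesis by simp
    qed
    then have "v \<in> fixed_vectors ?I T"
      using * v(1) by (auto simp: fixed_vectors_def W_def)
    then have "v \<in> fixed_vectors ?I H" by (simp add: fixed)
    with Hv v(1) show "v = 0" by (auto simp: fixed_vectors_def W_def fun_eq_iff)
  qed
  moreover have "(\<lambda>zs. if zs = ys then 1 else 0) \<in> W"
    using ys by (auto simp: W_def)
  ultimately obtain w where w: "f w = (\<lambda>zs. if zs = ys then 1 else 0)"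
    by (metis (no_types, lifting) imageE)
  show thesis
  proof (rule that[of w])
    fix zs assume "zs \<in> ?I"
    with fun_cong[OF w, of zs] show "w zs - (\<Sum>ws\<in>?I. T zs ws * w ws) + (\<Sum>ws\<in>?I. H zs ws * w ws)
      = (if zs = ys then 1 else 0)"
      by (simp only: f_def if_True)
  qed
qed

text \<open>Let \<open>\<tau> = (id \<otimes> \<phi>) \<Delta>\<close>. It preserves \<open>J\<close>, because \<open>\<phi>\<close> vanishes on \<open>J\<close>, and \<open>h \<circ> \<tau> = h\<close>. So it is
enough that every element of \<open>J\<close> is of the form \<open>a - \<tau> a\<close> with \<open>a \<in> J\<close>. This is a question about the
finite-dimensional spaces \<open>J \<inter> V\<close> with \<open>V\<close> in the length filtration, where it suffices that \<open>1 - \<tau>\<close>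
is injective. On \<open>V\<close> the map \<open>\<sigma> a = a - \<tau> a + h(a) 1\<close> acts through the invertible matrices
\<open>1 - T\<^sub>k + H\<^sub>k\<close>, so it is onto and hence injective. If now \<open>\<tau> a = a\<close>, then
\<open>\<sigma> a = h(a) 1 = \<sigma>(h(a) 1)\<close>, so that \<open>a\<close> is a scalar, and the counit shows that this scalar is \<open>0\<close>
for \<open>a \<in> J\<close>.\<close>

lemma haar_vanishes_on_ideal:
  assumes fixed: "\<And>k. fixed_vectors (multi_indices k) T = fixed_vectors (multi_indices k) H"
    and J: "hopf_star_ideal tens u \<Delta> \<epsilon> S J" "\<And>x. x \<in> J \<Longrightarrow> \<pi> x = 0"
    and x: "x \<in> J"
  shows "h x = 0"
proof -
  have "clinear (\<lambda>a. \<phi> b *\<^sub>C a)" for b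
    by (rule clinearI) (simp_all add: scaleC_add_right scaleC_scaleC mult.commute)
  moreover have "clinear (\<lambda>b. \<phi> b *\<^sub>C a)" for a :: 'a
    by (rule clinearI) (simp_all add: clinear_add[OF phi_linear] clinear_scale[OF phi_linear]
        scaleC_add_left scaleC_scaleC scaleC_complex_def)
  ultimately obtain g where g: "clinear g" "\<And>a b. g (tens a b) = \<phi> b *\<^sub>C a"
    using bilinear_extension[of "\<lambda>a b. \<phi> b *\<^sub>C a"] by blast
  define \<tau> where "\<tau> a = g (\<Delta> a)" for a
  define \<sigma> where "\<sigma> a = a - \<tau> a + h a *\<^sub>C 1" for a
  have tau: "clinear \<tau>"
    by (rule clinearI) (simp_all add: \<tau>_def clinear_add[OF Delta_linear]
        clinear_scale[OF Delta_linear] clinear_add[OF g(1)] clinear_scale[OF g(1)])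
  have sigma: "clinear \<sigma>"
    by (rule clinearI) (simp_all add: \<sigma>_def clinear_add[OF tau] clinear_scale[OF tau]
        clinear_add[OF h_linear] clinear_scale[OF h_linear] scaleC_complex_def scaleC_scaleC
        scaleC_add_left scaleC_add_right cstar.scale_right_diff_distrib)
  have tau_U: "\<tau> (U xs ys) = (\<Sum>zs\<in>multi_indices k. T zs ys *\<^sub>C U xs zs)"
    if "xs \<in> multi_indices k" "ys \<in> multi_indices k" for k xs ys
    by (simp add: \<tau>_def Delta_U[OF that] clinear_sum[OF g(1)] g(2))
  have tau_1: "\<tau> 1 = 1"
    using g(2)[of 1 1] by (simp add: \<tau>_def Delta_one tens_one phi_one scaleC_one)
  have h_tau: "h (\<tau> a) = h a" if "a \<in> \<A>" for a
  proof (rule A_eqI[OF _ h_linear that])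
    show "clinear (\<lambda>a. h (\<tau> a))"
      by (rule clinearI) (simp_all add: clinear_add[OF tau] clinear_scale[OF tau]
          clinear_add[OF h_linear] clinear_scale[OF h_linear])
    show "h (\<tau> (U xs ys)) = h (U xs ys)"
      if "xs \<in> multi_indices k" "ys \<in> multi_indices k" for k xs ys
      using H_T[OF that]
      by (simp add: tau_U[OF that] clinear_sum[OF h_linear] clinear_scale[OF h_linear]
          scaleC_complex_def mult.commute)
  qed
  have tau_J: "\<tau> a \<in> J" if "a \<in> J" for a
  proof -
    have "cstar.subspace J" using J(1) by (simp add: hopf_star_ideal_def)
    from J(1) that obtain y z where yz: "\<Delta> a = y + z"
      "y \<in> tensor_span tens J \<A>" "z \<in> tensor_span tens \<A> J"
      unfolding hopf_star_ideal_def by blast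
    have "g y \<in> J"
      by (rule tensor_span_into[OF g(1) yz(2) \<open>cstar.subspace J\<close>])
        (simp add: g(2) cstar.subspace_scale[OF \<open>cstar.subspace J\<close>])
    moreover have "g z = 0"
      by (rule tensor_span_zero[OF g(1) yz(3)]) (simp add: g(2) J(2) phi_pi_zero)
    ultimately show ?thesis by (simp add: \<tau>_def yz(1) clinear_add[OF g(1)])
  qed
  have J_A: "J \<subseteq> \<A>" and sub_J: "cstar.subspace J" and eps_J: "\<And>a. a \<in> J \<Longrightarrow> \<epsilon> a = 0"
    using J(1) by (simp_all add: hopf_star_ideal_def)
  obtain N where N: "x \<in> length_filtration N"
    using A_in_filtration x J_A by blast
  define V where "V = length_filtration N"
  obtain B where B: "finite B" "V = cstar.span B"
    unfolding V_def by (rule filtration_finitely_spanned)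
  have sub_V: "cstar.subspace V" by (simp add: V_def subspace_filtration)
  have one_V: "1 \<in> V"
    using U_in_filtration[of "[]" 0 "[]" N] by (simp add: V_def multi_indices_def)
  have tau_V: "\<tau> a \<in> V" if "a \<in> V" for a
  proof (rule filtration_into[OF tau that[unfolded V_def] sub_V])
    fix k and xs ys :: "'n list" assume k: "k \<le> N" "xs \<in> multi_indices k" "ys \<in> multi_indices k"
    show "\<tau> (U xs ys) \<in> V"
      unfolding tau_U[OF k(2,3)] V_def using k
      by (intro cstar.subspace_sum[OF subspace_filtration]
          cstar.subspace_scale[OF subspace_filtration] U_in_filtration)
  qed
  have sigma_V: "\<sigma> a \<in> V" if "a \<in> V" for a
    unfolding \<sigma>_def using that tau_V one_V
    by (intro cstar.subspace_add[OF sub_V] cstar.subspace_diff[OF sub_V] cstar.subspace_scale[OF sub_V])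
  have sigma_onto_U: "U xs ys \<in> \<sigma> ` V"
    if k: "k \<le> N" "xs \<in> multi_indices k" "ys \<in> multi_indices k" for k xs ys
  proof -
    let ?I = "multi_indices k :: 'n list set"
    obtain w where w: "\<And>zs. zs \<in> ?I \<Longrightarrow>
      w zs - (\<Sum>ws\<in>?I. T zs ws * w ws) + (\<Sum>ws\<in>?I. H zs ws * w ws) = (if zs = ys then 1 else 0)"
      using one_minus_T_plus_H_surjective[OF fixed k(3)] by blast
    define b where "b = (\<Sum>zs\<in>?I. w zs *\<^sub>C U xs zs)"
    have collect: "(\<Sum>ws\<in>?I. w ws *\<^sub>C (\<Sum>zs\<in>?I. M zs ws *\<^sub>C U xs zs))
      = (\<Sum>zs\<in>?I. (\<Sum>ws\<in>?I. M zs ws * w ws) *\<^sub>C U xs zs)" for M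
      unfolding cstar.scale_sum_right cstar.scale_sum_left
      by (subst sum.swap) (simp add: scaleC_scaleC mult.commute)
    have "\<tau> b = (\<Sum>ws\<in>?I. w ws *\<^sub>C (\<Sum>zs\<in>?I. T zs ws *\<^sub>C U xs zs))"
      unfolding b_def clinear_sum[OF tau] clinear_scale[OF tau]
      by (intro sum.cong refl) (simp add: tau_U[OF k(2)])
    moreover have "h b *\<^sub>C 1 = (\<Sum>ws\<in>?I. w ws *\<^sub>C (\<Sum>zs\<in>?I. H zs ws *\<^sub>C U xs zs))"
      unfolding b_def clinear_sum[OF h_linear] clinear_scale[OF h_linear] cstar.scale_sum_left
      by (intro sum.cong refl) (simp add: right_invariance[OF k(2)] scaleC_complex_def scaleC_scaleC)
    ultimately have "\<sigma> b = (\<Sum>zs\<in>?I. (w zs - (\<Sum>ws\<in>?I. T zs ws * w ws)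
        + (\<Sum>ws\<in>?I. H zs ws * w ws)) *\<^sub>C U xs zs)"
      unfolding \<sigma>_def collect
      by (simp add: b_def scaleC_add_left cstar.scale_left_diff_distrib sum.distrib sum_subtractf)
    also have "\<dots> = (\<Sum>zs\<in>?I. (if zs = ys then 1 else 0) *\<^sub>C U xs zs)"
      by (intro sum.cong refl) (simp only: w)
    also have "\<dots> = U xs ys"
      using k(3) by (simp add: sum_indicator_scale finite_multi_indices)
    finally have "\<sigma> b = U xs ys" .
    moreover have "b \<in> V"
      unfolding b_def V_def using k
      by (intro cstar.subspace_sum[OF subspace_filtration]
          cstar.subspace_scale[OF subspace_filtration] U_in_filtration)
    ultimately show ?thesis by (metis imageI)
  qed
  have "inj_on \<sigma> V"
  proof (rule surjective_imp_injective_on_subspace[OF sigma sub_V])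
    show "V \<subseteq> cstar.span B" "finite B" using B by simp_all
    interpret vector_space_pair "scaleC :: complex \<Rightarrow> 'a \<Rightarrow> 'a" "scaleC :: complex \<Rightarrow> 'a \<Rightarrow> 'a" ..
    have "cstar.subspace (\<sigma> ` V)"
      by (rule linear_subspace_image[OF sigma sub_V])
    moreover have "clinear (\<lambda>x :: 'a. x)"
      by (rule clinearI) auto
    ultimately have "V \<subseteq> \<sigma> ` V"
      using filtration_into[of "\<lambda>x. x"] sigma_onto_U unfolding V_def by blast
    then show "\<sigma> ` V = V" using sigma_V by blast
  qed
  define f where "f a = a - \<tau> a" for a
  have f: "clinear f"
    by (rule clinearI) (simp_all add: f_def clinear_add[OF tau] clinear_scale[OF tau]
        cstar.scale_right_diff_distrib)
  have "f ` (J \<inter> V) = J \<inter> V"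
  proof (rule injective_imp_surjective_on_subspace[OF f])
    show "cstar.subspace (J \<inter> V)" using sub_J sub_V by (rule cstar.subspace_inter)
    show "J \<inter> V \<subseteq> cstar.span B" "finite B" using B by auto
    show "f ` (J \<inter> V) \<subseteq> J \<inter> V"
      using tau_J tau_V cstar.subspace_diff[OF sub_J] cstar.subspace_diff[OF sub_V]
      by (auto simp: f_def)
    fix a assume a: "a \<in> J \<inter> V" "f a = 0"
    have "\<sigma> (h a *\<^sub>C 1) = h a *\<^sub>C 1"
      unfolding clinear_scale[OF sigma] by (simp add: \<sigma>_def tau_1 h_one scaleC_one)
    moreover have "\<sigma> a = h a *\<^sub>C 1"
      using a(2) by (simp add: \<sigma>_def f_def)
    ultimately have "\<sigma> a = \<sigma> (h a *\<^sub>C 1)" by (simp only:)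
    moreover have "h a *\<^sub>C 1 \<in> V" using one_V by (rule cstar.subspace_scale[OF sub_V])
    ultimately have eq: "a = h a *\<^sub>C 1"
      using a(1) by (blast dest: inj_onD[OF \<open>inj_on \<sigma> V\<close>])
    have "\<epsilon> a = \<epsilon> (h a *\<^sub>C 1)" using arg_cong[OF eq] .
    then have "h a = 0"
      using eps_J a(1) by (simp add: clinear_scale[OF eps_linear] eps_one scaleC_complex_def)
    with eq show "a = 0" by (metis cstar.scale_zero_left)
  qed
  then obtain a where "a \<in> J" "x = f a"
    using x N by (auto simp: V_def)
  then show ?thesis
    using h_tau J_A by (auto simp: f_def clinear_diff[OF h_linear])
qed

section \<open>Triviality of Hopf ideals on which the Haar functional vanishes\<close>

text \<open>Consider \<open>\<beta>(a, b) = (id \<otimes> h)(\<Delta>(a) (1 \<otimes> S(b)))\<close> as a linear map \<open>g\<close> on the algebraic tensor product.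
The antipode identity gives \<open>g (\<Delta> x) = x\<close>. On the other hand \<open>g\<close> vanishes on \<open>\<A> \<otimes> J\<close>, directly since
\<open>S(J) \<subseteq> J\<close> and \<open>h(J) = 0\<close>, and on \<open>J \<otimes> \<A>\<close>, because invariance of \<open>h\<close> permits moving the
comultiplication to the other factor: \<open>\<beta>(a, b) = \<Sum> h(a S(b\<^sub>1)) b\<^sub>2\<close>. Since \<open>\<Delta>(J)\<close> is contained in
\<open>J \<otimes> \<A> + \<A> \<otimes> J\<close>, it follows that \<open>J = 0\<close>.\<close>

lemma ideal_trivial_if_haar_vanishes:
  assumes J: "hopf_star_ideal tens u \<Delta> \<epsilon> S J" and h0: "\<And>x. x \<in> J \<Longrightarrow> h x = 0"
    and x: "x \<in> J"
  shows "x = 0"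
proof -
  obtain E where E: "clinear E" "\<And>a b. E (tens a b) = h b *\<^sub>C a" "\<And>a. E (\<Delta> a) = h a *\<^sub>C 1"
    using haar_right_slice by blast
  note linear_simps = tens_simps S_mult clinear_add[OF S_linear] clinear_scale[OF S_linear]
    clinear_add[OF Delta_linear] clinear_scale[OF Delta_linear] clinear_add[OF E(1)]
    clinear_scale[OF E(1)] distrib_left distrib_right mult_scaleC_left mult_scaleC_right
  define \<beta> where "\<beta> a b = E (\<Delta> a * tens 1 (S b))" for a b
  have beta_left: "clinear (\<lambda>a. \<beta> a b)" for b
    by (rule clinearI) (simp_all add: \<beta>_def linear_simps)
  have beta_right: "clinear (\<beta> a)" for a
    by (rule clinearI) (simp_all add: \<beta>_def linear_simps)
  obtain g where g: "clinear g" "\<And>a b. g (tens a b) = \<beta> a b"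
    using bilinear_extension[OF beta_left beta_right] by blast
  have beta_U_left: "\<beta> (U xs ys) b = (\<Sum>zs\<in>multi_indices k. h (U zs ys * S b) *\<^sub>C U xs zs)"
    if "xs \<in> multi_indices k" "ys \<in> multi_indices k" for k xs ys b
    by (simp add: \<beta>_def Delta_U[OF that] sum_distrib_right tens_mult clinear_sum[OF E(1)] E(2))
  \<comment> \<open>The slice map is a module map for the factor that it leaves alone.\<close>
  have E_module: "E (s * tens c 1) = E s * c" if "s \<in> tensor_span tens UNIV UNIV" for s c
  proof (rule clinear_eq_on_span[OF _ _ that[unfolded tensor_span_def]])
    show "clinear (\<lambda>s. E (s * tens c 1))" "clinear (\<lambda>s. E s * c)"
      by (rule clinearI; simp add: linear_simps)+
  qed (auto simp: tens_mult E(2) mult_scaleC_left)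
  have beta_U_right: "\<beta> a (U xs ys) = (\<Sum>zs\<in>multi_indices k. h (a * star (U zs xs)) *\<^sub>C U zs ys)"
    if a: "a \<in> \<A>" and xs: "xs \<in> multi_indices k" and ys: "ys \<in> multi_indices k" for a k xs ys
  proof -
    let ?I = "multi_indices k :: 'n list set"
    have "\<Delta> a \<in> tensor_span tens UNIV UNIV"
      using Delta_in_tensor_span[OF a] tensor_span_mono[of \<A> UNIV \<A> UNIV tens] by blast
    then have span: "\<Delta> a * tens b c \<in> tensor_span tens UNIV UNIV" for b c
      by (rule tensor_span_mult[OF _ tensor_span_tens[of _ UNIV _ UNIV]]) auto
    have "(\<Sum>zs\<in>?I. h (a * star (U zs xs)) *\<^sub>C U zs ys)
      = (\<Sum>zs\<in>?I. E (\<Delta> (a * star (U zs xs))) * U zs ys)"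
      by (simp add: E(3) mult_scaleC_left)
    also have "\<dots> = (\<Sum>zs\<in>?I. \<Sum>ws\<in>?I.
        E (\<Delta> a * tens (star (U zs ws)) (star (U ws xs))) * U zs ys)"
      by (intro sum.cong refl) (simp add: Delta_mult Delta_star_U[OF _ xs] sum_distrib_left
          sum_distrib_right clinear_sum[OF E(1)])
    also have "\<dots> = (\<Sum>zs\<in>?I. \<Sum>ws\<in>?I.
        E (\<Delta> a * tens (star (U zs ws) * U zs ys) (star (U ws xs))))"
      by (intro sum.cong refl) (simp add: E_module[OF span, symmetric] mult.assoc tens_mult)
    also have "\<dots> = (\<Sum>ws\<in>?I.
        E (\<Delta> a * tens (\<Sum>zs\<in>?I. star (U zs ws) * U zs ys) (star (U ws xs))))"
      by (subst sum.swap) (simp add: tens_simps sum_distrib_left clinear_sum[OF E(1)])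
    also have "\<dots> = (\<Sum>ws\<in>?I. if ws = ys then E (\<Delta> a * tens 1 (star (U ws xs))) else 0)"
      by (intro sum.cong refl)
        (simp add: U_isometry[OF _ ys] tens_simps clinear_zero[OF E(1)])
    also have "\<dots> = \<beta> a (U xs ys)"
      using ys S_U[of xs ys] xs by (simp add: finite_multi_indices \<beta>_def) (simp add: multi_indices_def)
    finally show ?thesis ..
  qed
  have g_Delta: "g (\<Delta> a) = a" if "a \<in> \<A>" for a
  proof (rule A_eqI[OF _ _ that])
    show "clinear (\<lambda>a. g (\<Delta> a))" "clinear (\<lambda>a :: 'a. a)"
      by (rule clinearI; simp add: linear_simps clinear_add[OF g(1)] clinear_scale[OF g(1)])+
    fix k and xs ys :: "'n list" assume k: "xs \<in> multi_indices k" "ys \<in> multi_indices k"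
    let ?I = "multi_indices k :: 'n list set"
    have "g (\<Delta> (U xs ys)) = (\<Sum>zs\<in>?I. \<Sum>ws\<in>?I. h (U ws zs * star (U ys zs)) *\<^sub>C U xs ws)"
      unfolding Delta_U[OF k] clinear_sum[OF g(1)] g(2)
      by (intro sum.cong refl) (use k in \<open>simp add: beta_U_left[OF k(1)] S_U multi_indices_def\<close>)
    also have "\<dots> = (\<Sum>ws\<in>?I. h (\<Sum>zs\<in>?I. U ws zs * star (U ys zs)) *\<^sub>C U xs ws)"
      by (subst sum.swap) (simp add: clinear_sum[OF h_linear] cstar.scale_sum_left)
    also have "\<dots> = (\<Sum>ws\<in>?I. (if ws = ys then 1 else 0) *\<^sub>C U xs ws)"
      by (intro sum.cong refl) (simp add: U_coisometry[OF _ k(2)] h_one clinear_zero[OF h_linear])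
    also have "\<dots> = U xs ys"
      using k by (simp add: sum_indicator_scale finite_multi_indices)
    finally show "g (\<Delta> (U xs ys)) = U xs ys" .
  qed
  have J_A: "J \<subseteq> \<A>" and J_mult: "\<And>a x. a \<in> \<A> \<Longrightarrow> x \<in> J \<Longrightarrow> a * x \<in> J \<and> x * a \<in> J"
    and J_S: "\<And>x. x \<in> J \<Longrightarrow> S x \<in> J"
    using J by (simp_all add: hopf_star_ideal_def)
  have zero_linear: "clinear (\<lambda>a :: 'a. 0 :: 'a)"
    by (rule clinearI) auto
  from J x obtain y z where yz: "\<Delta> x = y + z"
    "y \<in> tensor_span tens J \<A>" "z \<in> tensor_span tens \<A> J"
    unfolding hopf_star_ideal_def by blast
  have "g y = 0"
  proof (rule tensor_span_zero[OF g(1) yz(2)])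
    fix a b assume ab: "a \<in> J" "b \<in> \<A>"
    have "\<beta> a b = 0"
    proof (rule A_eqI[OF beta_right zero_linear ab(2)])
      fix k and xs ys :: "'n list" assume k: "xs \<in> multi_indices k" "ys \<in> multi_indices k"
      have "h (a * star (U zs xs)) = 0" if "zs \<in> multi_indices k" for zs
        using that k ab(1) by (intro h0 conjunct2[OF J_mult] star_subalgebra_A(4) U_in_A)
          (auto simp: multi_indices_def)
      then show "\<beta> a (U xs ys) = 0"
        using beta_U_right[OF _ k] ab(1) J_A by auto
    qed
    then show "g (tens a b) = 0" by (simp add: g(2))
  qed
  moreover have "g z = 0"
  proof (rule tensor_span_zero[OF g(1) yz(3)])
    fix a b assume ab: "a \<in> \<A>" "b \<in> J"
    have "\<beta> a b = 0"
    proof (rule A_eqI[OF beta_left zero_linear ab(1)])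
      fix k and xs ys :: "'n list" assume k: "xs \<in> multi_indices k" "ys \<in> multi_indices k"
      have "h (U zs ys * S b) = 0" if "zs \<in> multi_indices k" for zs
        using that k ab(2) by (intro h0 conjunct1[OF J_mult] J_S U_in_A)
          (auto simp: multi_indices_def)
      then show "\<beta> (U xs ys) b = 0"
        using beta_U_left[OF k] by simp
    qed
    then show "g (tens a b) = 0" by (simp add: g(2))
  qed
  ultimately have "g (\<Delta> x) = 0"
    by (simp add: yz(1) clinear_add[OF g(1)])
  with g_Delta x J_A show ?thesis by auto
qed

section \<open>The equivalence\<close>

lemma inner_faithful_if_fixed_vectors_eq:
  assumes "\<And>k. fixed_vectors (multi_indices k) T = fixed_vectors (multi_indices k) H"
  shows "inner_faithful tens u \<Delta> \<epsilon> S \<pi>"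
proof -
  let ?J = "hopf_image_ideal tens u \<Delta> \<epsilon> S \<pi>"
  have J: "hopf_star_ideal tens u \<Delta> \<epsilon> S ?J" "\<And>x. x \<in> ?J \<Longrightarrow> \<pi> x = 0"
    using hopf_image_ideal_greatest(1)[OF hopf rep] by auto
  have "x = 0" if "x \<in> ?J" for x
    using ideal_trivial_if_haar_vanishes[OF J(1) haar_vanishes_on_ideal[OF assms J] that] .
  moreover have "0 \<in> ?J"
    using J(1) cstar.subspace_0 by (auto simp: hopf_star_ideal_def)
  ultimately show ?thesis
    unfolding inner_faithful_iff by blast
qed

lemma inner_faithful_iff_multiplicity_le:
  "inner_faithful tens u \<Delta> \<epsilon> S \<pi> \<longleftrightarrow>
    (\<forall>k\<ge>1. of_nat (eigenvalue_multiplicity (multi_indices k) T 1) \<le> h (trace u ^ k))"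
proof -
  \<comment> \<open>The matrices \<open>T\<^sub>0\<close> and \<open>H\<^sub>0\<close> are both the \<open>1 \<times> 1\<close> identity matrix.\<close>
  have "fixed_vectors (multi_indices 0) T = fixed_vectors (multi_indices 0) H"
    by (simp add: fixed_vectors_def multi_indices_0 phi_one h_one)
  then have "(\<forall>k. fixed_vectors (multi_indices k) T = fixed_vectors (multi_indices k) H) \<longleftrightarrow>
    (\<forall>k\<ge>1. fixed_vectors (multi_indices k) T = fixed_vectors (multi_indices k) H)"
    by (metis One_nat_def Suc_leI neq0_conv)
  then show ?thesis
    unfolding multiplicity_le_iff
    using inner_faithful_if_fixed_vectors_eq fixed_vectors_eq_if_inner_faithful by blast
qed

end

theorem theorem3p2:
  fixes tens :: "'a::cstar_algebra \<Rightarrow> 'a \<Rightarrow> 't::cstar_algebra"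
    and u :: "'a^'n^'n"
    and \<Delta> :: "'a \<Rightarrow> 't" and \<epsilon> :: "'a \<Rightarrow> complex" and S :: "'a \<Rightarrow> 'a"
    and h :: "'a \<Rightarrow> complex"
    and \<pi> :: "'a \<Rightarrow> complex^'m^'m"
  assumes "orthogonal_hopf_cstar_algebra tens u \<Delta> \<epsilon> S"
    and "haar_functional tens \<Delta> h"
    and "matrix_representation \<pi>"
  shows "inner_faithful tens u \<Delta> \<epsilon> S \<pi> \<longleftrightarrow>
    (\<forall>k::nat. k \<ge> 1 \<longrightarrow>
      of_nat (eigenvalue_multiplicity (multi_indices k) (T_matrix (\<lambda>i j. \<pi> (u $ i $ j))) 1)
        \<le> h (trace u ^ k))"
proof -
  interpret hopf_representation tens u \<Delta> \<epsilon> S h \<pi>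
    by unfold_locales fact+
  have "T_matrix (\<lambda>i j. \<pi> (u $ i $ j)) = T"
    by (intro ext) (rule T_matrix_eq)
  then show ?thesis
    using inner_faithful_iff_multiplicity_le by simp
qed

end
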